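(* Let the perturbed system described in the context satisfy the standing assumptions (i)–(iv) listed there. Let $n$ be the integer such that $\Lambda_k(\rho)\equiv0$ for $k\le n-1$ and $\Lambda_n(\rho)\not\equiv0$, and assume that $n<p$, $n=q$, and $\Lambda_n(\rho)=\rho(\lambda_n+\mathcal O(|\rho|))$ as $\rho\to0$ with a constant $\lambda_n<0$. Then for all $\varepsilon>0$ there exist $\delta_0>0$ and $t_0\ge t_\ast$ such that every solution $r(t),\varphi(t)$ of the perturbed system with initial data $|r(t_0)|\le\delta_0$ and $\varphi(t_0)\in\mathbb R$ satisfies the inequality $|r(t)|<\varepsilon$ for all $t\ge t_0$.
   Context: $\mathbb Z_+=\{1,2,\dots\}$. Perturbed system: fix $r_0>0$, $q\in\mathbb Z_+$ and consider $$\frac{dr}{dt}=f(r,\varphi,S(t),t),\qquad \frac{d\varphi}{dt}=\omega(r)+r^{-1}g(r,\varphi,S(t),t),$$ where $\omega(r)$, $f(r,\varphi,S,t)$, $g(r,\varphi,S,t)$ are infinitely differentiable, defined for all $|r|\le r_0$, $(\varphi,S)\in\mathbb R^2$, $t>0$, and $2\pi$-periodic with respect to $\varphi$ and $S$; $\omega(r)>0$ for all $|r|\le r_0$. Standing assumptions: (i) as $t\to\infty$, $f(r,\varphi,S,t)\sim\sum_{k=1}^\infty t^{-k/q}f_k(r,\varphi,S)$ and $g(r,\varphi,S,t)\sim\sum_{k=1}^\infty t^{-k/q}g_k(r,\varphi,S)$ for all $|r|\le r_0$, $(\varphi,S)\in\mathbb R^2$, where $f_k,g_k$ are $2\pi$-periodic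 in $\varphi$ and $S$ and their Fourier series $f_k=\sum_{(k_1,k_2)\in\mathbb Z^2}f_{k,k_1,k_2}(r)e^{i(k_1\varphi+k_2S)}$, $g_k=\sum_{(k_1,k_2)\in\mathbb Z^2}g_{k,k_1,k_2}(r)e^{i(k_1\varphi+k_2S)}$ contain a finite number of harmonics $e^{ik_2S}$; (ii) there is $p\in\mathbb Z_+$ such that $|f_k(r,\varphi,S)|+|g_k(r,\varphi,S)|=\mathcal O(r)$ as $r\to0$ for $k<p$, and $f_{p,0,0}(0)\ne0$; (iii) $S(t)=s_0t+\sum_{k=1}^{q-1}s_kt^{1-k/q}+s_q\log t$ with real constants $s_k$, $s_0>0$; (iv) (non-resonance) $k_1\omega(0)+k_2s_0\ne0$ for all $k_1,k_2\in\mathbb Z$ with $|k_1|+|k_2|\ne0$. The functions $\Lambda_k$: fix an integer $N\in[p,2p)$. Let $\langle Z\rangle_{\varphi,S}=(2\pi)^{-2}\int_0^{2\pi}\int_0^{2\pi}Z\,d\varphi\,dS$. Write $S'(t)=s_0+\sum_{i=1}^q\sigma_it^{-i/q}$, i.e. $\sigma_i=(1-i/q)s_i$ for $i<q$, $\sigma_q=s_q$, and $\sigma_i=0$ for $i>q$; put $v_i\equiv0$ for $i<1$ or $i>N$. For $k=1,\dots,N$ define successively $$\mathcal R_k=[\epsilon^k]\sum_{j\ge1}\epsilon^j\Big(\Lambda_j\big(r+\sum_{i\ge1}\epsilon^iv_i\big)-\Lambda_j(r)\Big)-\Big(1-\frac kq\Big)v_{k-q}-\sum_{i+j=k,\ i,j\ge1}\Big(f_i\partial_r+r^{-1}g_i\partial_\varphi+\sigma_i\partial_S\Big)v_j,$$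 where $[\epsilon^k]$ is the coefficient of $\epsilon^k$ in the formal Taylor expansion (so $\mathcal R_k$ depends only on $\Lambda_j,v_j$ with $j<k$), $\Lambda_k(r)=\langle f_k-\mathcal R_k\rangle_{\varphi,S}$, and $v_k(r,\varphi,S)$ is the $2\pi$-periodic zero-mean solution of $(\omega(r)\partial_\varphi+s_0\partial_S)v_k=\Lambda_k-f_k+\mathcal R_k$ obtained by dividing the Fourier coefficients of the right-hand side by $i(k_1\omega(r)+k_2s_0)$. Here $|r|\le r_\ast$, where $r_\ast\in(0,r_0)$ is chosen so that $k_1\omega(r)+k_2s_0\ne0$ for $|r|\le r_\ast$, all $k_1\in\mathbb Z$ and all $k_2$ in the finite set of $S$-frequencies that occur, $|k_1|+|k_2|\ne0$. The number $t_\ast>0$ is fixed so large that $(r,\varphi,t)\mapsto(V_N,\varphi,t)$, $V_N=r+\sum_{k=1}^Nt^{-k/q}v_k(r,\varphi,S(t))$, is an invertible near-identity change of variables for $|r|\le r_\ast$, $\varphi\in\mathbb R$, $t\ge t_\ast$. *)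

theory Defs
  imports "HOL-Analysis.Analysis" "HOL-Library.Landau_Symbols"
begin

text \<open>Differentiability is taken within \<open>D\<close>, so that closed slabs such as \<open>\<bar>r\<bar> \<le> r0\<close> are allowed
  (one-sided derivatives at the boundary). On the domains used below, which are convex with
  nonempty interior, the derivative within \<open>D\<close> is unique.\<close>

primrec Ck_on :: "nat \<Rightarrow> ('a::real_normed_vector \<Rightarrow> real) \<Rightarrow> 'a set \<Rightarrow> bool" where
  "Ck_on 0 h D \<longleftrightarrow> continuous_on D h"
| "Ck_on (Suc m) h D \<longleftrightarrow>
     (\<exists>h'. (\<forall>x\<in>D. (h has_derivative h' x) (at x within D)) \<and> (\<forall>e. Ck_on m (\<lambda>x. h' x e) D))"

definition smooth_on :: "('a::real_normed_vector \<Rightarrow> real) \<Rightarrow> 'a set \<Rightarrow> bool" where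
  "smooth_on h D \<longleftrightarrow> (\<forall>m. Ck_on m h D)"

definition slab :: "real \<Rightarrow> (real \<times> real \<times> real) set" where
  "slab \<rho> = {(r, \<phi>, S). \<bar>r\<bar> \<le> \<rho>}"

definition periodic2 :: "(real \<Rightarrow> real \<Rightarrow> real) \<Rightarrow> bool" where
  "periodic2 h \<longleftrightarrow> (\<forall>\<phi> S. h (\<phi> + 2 * pi) S = h \<phi> S \<and> h \<phi> (S + 2 * pi) = h \<phi> S)"

definition torus_mean :: "(real \<Rightarrow> real \<Rightarrow> 'b::real_normed_vector) \<Rightarrow> 'b" where
  "torus_mean Z =
     (1 / (2 * pi)\<^sup>2) *\<^sub>R integral {0..2 * pi} (\<lambda>S. integral {0..2 * pi} (\<lambda>\<phi>. Z \<phi> S))"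

definition fourier_coeff :: "(real \<Rightarrow> real \<Rightarrow> real) \<Rightarrow> int \<Rightarrow> int \<Rightarrow> complex" where
  "fourier_coeff h k1 k2 =
     torus_mean (\<lambda>\<phi> S. complex_of_real (h \<phi> S) * cis (- (of_int k1 * \<phi> + of_int k2 * S)))"

definition finite_S_harmonics :: "real \<Rightarrow> (real \<Rightarrow> real \<Rightarrow> real \<Rightarrow> real) \<Rightarrow> bool" where
  "finite_S_harmonics \<rho> h \<longleftrightarrow> finite {k2. \<exists>k1 r. \<bar>r\<bar> \<le> \<rho> \<and> fourier_coeff (h r) k1 k2 \<noteq> 0}"

text \<open>The asymptotic series \<open>h \<sim> \<Sum>k\<ge>1. t powr (-k/q) * hk k\<close> as \<open>t \<rightarrow> \<infinity>\<close>, uniformly for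
  \<open>(r, \<phi>, S)\<close> in \<open>slab \<rho>\<close>: uniformity is what the product with the principal filter expresses.\<close>

definition asymptotic_series ::
  "nat \<Rightarrow> real \<Rightarrow> (real \<Rightarrow> real \<Rightarrow> real \<Rightarrow> real \<Rightarrow> real) \<Rightarrow> (nat \<Rightarrow> real \<Rightarrow> real \<Rightarrow> real \<Rightarrow> real) \<Rightarrow> bool"
where
  "asymptotic_series q \<rho> h hk \<longleftrightarrow>
     (\<forall>M. (\<lambda>(t, (r, \<phi>, S)). h r \<phi> S t - (\<Sum>k = 1..M. t powr (- real k / real q) * hk k r \<phi> S))
            \<in> O[at_top \<times>\<^sub>F principal (slab \<rho>)](\<lambda>(t, _). t powr (- real (M + 1) / real q)))"

definition phase :: "nat \<Rightarrow> (nat \<Rightarrow> real) \<Rightarrow> real \<Rightarrow> real" where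
  "phase q s t = s 0 * t + (\<Sum>k = 1..<q. s k * t powr (1 - real k / real q)) + s q * ln t"

text \<open>The coefficients of \<open>S'(t) = s 0 + (\<Sum>i = 1..q. \<sigma>\<^sub>i * t powr (-i/q))\<close>.\<close>

definition phase_rate :: "nat \<Rightarrow> (nat \<Rightarrow> real) \<Rightarrow> nat \<Rightarrow> real" where
  "phase_rate q s i =
     (if 1 \<le> i \<and> i < q then (1 - real i / real q) * s i else if i = q then s q else 0)"

text \<open>A solution on an arbitrary interval \<open>J \<subseteq> {0<..}\<close> of times. The equation for \<open>\<phi>\<close> is singular at
  \<open>r = 0\<close>, so it is imposed only where \<open>r t \<noteq> 0\<close>. A solution crossing \<open>r = 0\<close> is merely required to
  have a differentiable \<open>\<phi>\<close> there, which covers every way of giving \<open>g / r\<close> a value at \<open>r = 0\<close>.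
  Since \<open>\<phi>\<close> may blow up when \<open>r\<close> reaches 0, not every solution is global; statements about all
  later times are therefore made on arbitrary intervals of existence, \<open>{t0..}\<close> being one of them.\<close>

definition solution_on ::
  "real \<Rightarrow> (real \<Rightarrow> real) \<Rightarrow> (real \<Rightarrow> real \<Rightarrow> real \<Rightarrow> real \<Rightarrow> real) \<Rightarrow> (real \<Rightarrow> real \<Rightarrow> real \<Rightarrow> real \<Rightarrow> real)
     \<Rightarrow> (real \<Rightarrow> real) \<Rightarrow> real set \<Rightarrow> (real \<Rightarrow> real) \<Rightarrow> (real \<Rightarrow> real) \<Rightarrow> bool"
where
  "solution_on r0 \<omega> f g S J r \<phi> \<longleftrightarrow>
     is_interval J \<and> J \<subseteq> {0<..} \<and>
     (\<forall>t\<in>J. \<bar>r t\<bar> \<le> r0 \<and>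
        (r has_real_derivative f (r t) (\<phi> t) (S t) t) (at t within J) \<and>
        \<phi> differentiable (at t within J) \<and>
        (r t \<noteq> 0 \<longrightarrow>
           (\<phi> has_real_derivative \<omega> (r t) + inverse (r t) * g (r t) (\<phi> t) (S t) t) (at t within J)))"

text \<open>The formula for \<open>R\<^sub>k\<close>. The first summand is the coefficient of \<open>\<epsilon>^k\<close> in
  \<open>\<Sum>j\<ge>1. \<epsilon>^j * (\<Lambda>\<^sub>j (r + (\<Sum>i\<ge>1. \<epsilon>^i * v\<^sub>i)) - \<Lambda>\<^sub>j r)\<close>, as formal power series in \<open>\<epsilon>\<close>; the terms with
  \<open>j \<ge> k\<close> contribute nothing. It is used with \<open>v 0 = 0\<close>, which makes the composition of series
  meaningful and also makes \<open>v (k - q)\<close> vanish for \<open>k \<le> q\<close> (truncated subtraction).\<close>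

definition taylor_fps :: "(real \<Rightarrow> real) \<Rightarrow> real \<Rightarrow> real fps" where
  "taylor_fps L r = Abs_fps (\<lambda>m. (deriv ^^ m) L r / fact m)"

definition R_formula ::
  "nat \<Rightarrow> (nat \<Rightarrow> real) \<Rightarrow> (nat \<Rightarrow> real \<Rightarrow> real \<Rightarrow> real \<Rightarrow> real) \<Rightarrow> (nat \<Rightarrow> real \<Rightarrow> real \<Rightarrow> real \<Rightarrow> real)
     \<Rightarrow> (nat \<Rightarrow> real \<Rightarrow> real) \<Rightarrow> (nat \<Rightarrow> real \<Rightarrow> real \<Rightarrow> real \<Rightarrow> real) \<Rightarrow> nat \<Rightarrow> real \<Rightarrow> real \<Rightarrow> real \<Rightarrow> real"
where
  "R_formula q s fk gk \<Lambda> v k r \<phi> S =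
     fps_nth (\<Sum>j = 1..k. fps_X ^ j *
        (fps_compose (taylor_fps (\<Lambda> j) r) (Abs_fps (\<lambda>i. v i r \<phi> S)) - fps_const (\<Lambda> j r))) k
     - (1 - real k / real q) * v (k - q) r \<phi> S
     - (\<Sum>(i, j) \<in> {(i, j). i + j = k \<and> 1 \<le> i \<and> 1 \<le> j}.
          fk i r \<phi> S * deriv (\<lambda>x. v j x \<phi> S) r
          + inverse r * gk i r \<phi> S * deriv (\<lambda>x. v j r x S) \<phi>
          + phase_rate q s i * deriv (\<lambda>x. v j r \<phi> x) S)"

definition homological_rhs ::
  "(nat \<Rightarrow> real \<Rightarrow> real \<Rightarrow> real \<Rightarrow> real) \<Rightarrow> (nat \<Rightarrow> real \<Rightarrow> real) \<Rightarrow> (nat \<Rightarrow> real \<Rightarrow> real \<Rightarrow> real \<Rightarrow> real)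
     \<Rightarrow> nat \<Rightarrow> real \<Rightarrow> real \<Rightarrow> real \<Rightarrow> real"
where
  "homological_rhs fk \<Lambda> R k r \<phi> S = \<Lambda> k r - fk k r \<phi> S + R k r \<phi> S"

text \<open>\<open>\<Lambda>\<close>, \<open>v\<close>, \<open>R\<close> are the functions obtained by the recursive averaging construction with \<open>N\<close> steps on
  \<open>\<bar>r\<bar> \<le> rs\<close>. The formula for \<open>R\<^sub>k\<close> contains \<open>1 / r\<close> (a removable singularity) and two-sided
  \<open>r\<close>-derivatives, so it is imposed for \<open>0 < \<bar>r\<bar> < rs\<close>, and \<open>R\<^sub>k\<close> is its continuous extension to
  \<open>\<bar>r\<bar> \<le> rs\<close>. These clauses determine \<open>R\<^sub>k\<close>, \<open>\<Lambda>\<^sub>k\<close>, \<open>v\<^sub>k\<close> uniquely on \<open>\<bar>r\<bar> \<le> rs\<close> by recursion on \<open>k\<close>: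
  \<open>v\<^sub>k\<close> is continuous and periodic with prescribed Fourier coefficients. Where the divisor
  vanishes, the Fourier coefficient of the right-hand side is 0 under \<open>nonresonant_radius\<close>
  below, and so is that of \<open>v\<^sub>k\<close>.\<close>

definition averaging_construction ::
  "nat \<Rightarrow> (nat \<Rightarrow> real) \<Rightarrow> (real \<Rightarrow> real) \<Rightarrow> (nat \<Rightarrow> real \<Rightarrow> real \<Rightarrow> real \<Rightarrow> real)
     \<Rightarrow> (nat \<Rightarrow> real \<Rightarrow> real \<Rightarrow> real \<Rightarrow> real) \<Rightarrow> nat \<Rightarrow> real
     \<Rightarrow> (nat \<Rightarrow> real \<Rightarrow> real) \<Rightarrow> (nat \<Rightarrow> real \<Rightarrow> real \<Rightarrow> real \<Rightarrow> real)
     \<Rightarrow> (nat \<Rightarrow> real \<Rightarrow> real \<Rightarrow> real \<Rightarrow> real) \<Rightarrow> bool"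
where
  "averaging_construction q s \<omega> fk gk N rs \<Lambda> v R \<longleftrightarrow>
     (\<forall>k. k \<notin> {1..N} \<longrightarrow> v k = (\<lambda>r \<phi> S. 0)) \<and>
     (\<forall>k\<in>{1..N}.
        continuous_on (slab rs) (\<lambda>(r, \<phi>, S). R k r \<phi> S) \<and>
        (\<forall>r \<phi> S. 0 < \<bar>r\<bar> \<and> \<bar>r\<bar> < rs \<longrightarrow> R k r \<phi> S = R_formula q s fk gk \<Lambda> v k r \<phi> S) \<and>
        (\<forall>r. \<bar>r\<bar> \<le> rs \<longrightarrow> \<Lambda> k r = torus_mean (\<lambda>\<phi> S. fk k r \<phi> S - R k r \<phi> S)) \<and>
        smooth_on (\<lambda>(r, \<phi>, S). v k r \<phi> S) (slab rs) \<and>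
        (\<forall>r. \<bar>r\<bar> \<le> rs \<longrightarrow>
           periodic2 (v k r) \<and> torus_mean (v k r) = 0 \<and>
           (\<forall>\<phi> S. \<omega> r * deriv (\<lambda>x. v k r x S) \<phi> + s 0 * deriv (\<lambda>x. v k r \<phi> x) S
                    = homological_rhs fk \<Lambda> R k r \<phi> S) \<and>
           (\<forall>k1 k2. (k1, k2) \<noteq> (0, 0) \<longrightarrow>
              fourier_coeff (v k r) k1 k2
                = fourier_coeff (homological_rhs fk \<Lambda> R k r) k1 k2
                    / (\<i> * complex_of_real (of_int k1 * \<omega> r + of_int k2 * s 0)))))"

text \<open>The \<open>S\<close>-frequencies that occur in the equations for \<open>v\<^sub>1, \<dots>, v\<^sub>N\<close>, and the choice of \<open>rs\<close>
  which keeps the corresponding divisors away from 0.\<close>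

definition S_frequencies ::
  "(nat \<Rightarrow> real \<Rightarrow> real \<Rightarrow> real \<Rightarrow> real) \<Rightarrow> (nat \<Rightarrow> real \<Rightarrow> real) \<Rightarrow> (nat \<Rightarrow> real \<Rightarrow> real \<Rightarrow> real \<Rightarrow> real)
     \<Rightarrow> nat \<Rightarrow> real \<Rightarrow> int set"
where
  "S_frequencies fk \<Lambda> R N rs =
     {k2. \<exists>k\<in>{1..N}. \<exists>k1 r. \<bar>r\<bar> \<le> rs \<and> fourier_coeff (homological_rhs fk \<Lambda> R k r) k1 k2 \<noteq> 0}"

definition nonresonant_radius :: "(real \<Rightarrow> real) \<Rightarrow> real \<Rightarrow> int set \<Rightarrow> real \<Rightarrow> bool" where
  "nonresonant_radius \<omega> s0 K rs \<longleftrightarrow>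
     (\<forall>r k1. \<forall>k2\<in>K. \<bar>r\<bar> \<le> rs \<and> \<bar>k1\<bar> + \<bar>k2\<bar> \<noteq> 0 \<longrightarrow> of_int k1 * \<omega> r + of_int k2 * s0 \<noteq> 0)"

text \<open>\<open>V\<^sub>N\<close> as a function of \<open>(r, \<phi>, t)\<close>. It is near-identity by its very form; invertibility for
  \<open>t \<ge> ts\<close> is invertibility onto the image.\<close>

definition V_change ::
  "nat \<Rightarrow> (real \<Rightarrow> real) \<Rightarrow> nat \<Rightarrow> (nat \<Rightarrow> real \<Rightarrow> real \<Rightarrow> real \<Rightarrow> real) \<Rightarrow> real \<Rightarrow> real \<Rightarrow> real \<Rightarrow> real"
where
  "V_change q S N v r \<phi> t = r + (\<Sum>k = 1..N. t powr (- real k / real q) * v k r \<phi> (S t))"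

definition invertible_change ::
  "nat \<Rightarrow> (real \<Rightarrow> real) \<Rightarrow> nat \<Rightarrow> (nat \<Rightarrow> real \<Rightarrow> real \<Rightarrow> real \<Rightarrow> real) \<Rightarrow> real \<Rightarrow> real \<Rightarrow> bool"
where
  "invertible_change q S N v rs ts \<longleftrightarrow>
     inj_on (\<lambda>(r, \<phi>, t). (V_change q S N v r \<phi> t, \<phi>, t)) {(r, \<phi>, t). \<bar>r\<bar> \<le> rs \<and> ts \<le> t}"

end

theory Submission
  imports Defs
begin

text \<open>The radius can grow from \<open>a\<close> to \<open>2 * a\<close> only by crossing the annulus \<open>a \<le> \<bar>r\<bar> \<le> 2 * a\<close>,
  and the theorem holds because late crossings are impossible. On the annulus the factor \<open>1 / r\<close> is bounded
  by \<open>1 / a\<close>, so there the averaging transformation has uniform error bounds, with constants that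
  depend on \<open>a\<close>; the initial time is chosen after \<open>a\<close>, so this dependence is harmless.

  Truncate the change of variables after step \<open>q\<close>, \<open>V = r + (\<Sum>k = 1..q. t powr (-k/q) * v\<^sub>k)\<close>. Differentiate
  along a solution and expand in powers of \<open>x = t powr (-1/q)\<close>. The homological equations replace the
  coefficient of \<open>x^k\<close> by \<open>\<Lambda>\<^sub>k\<close> for \<open>k \<le> q\<close>, and everything else is of order \<open>x^(q+1)\<close>. Since
  \<open>\<Lambda>\<^sub>k = 0\<close> for \<open>k < q\<close>, this gives (lemma \<open>averaging_on_annulus\<close>)
  \<open>V' = \<Lambda>\<^sub>q(r) / t + O(t powr (-1 - 1/q))\<close> and \<open>V = r + O(t powr (-1/q))\<close>.

  For small \<open>a\<close> the leading term points towards the origin because \<open>\<lambda> < 0\<close>, and the error term is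
  integrable in time. Hence \<open>\<bar>V\<bar>\<close>, and with it \<open>\<bar>r\<bar>\<close>, grows during a crossing by at most a
  constant times \<open>t0 powr (-1/q)\<close>, which is less than \<open>a\<close> for large \<open>t0\<close> (lemma \<open>barrier\<close>).\<close>

section \<open>Crossing an interval\<close>

lemma up_crossing:
  fixes u :: "real \<Rightarrow> real"
  assumes cont: "continuous_on {t0..t1} u" and "t0 \<le> t1" and "u t0 \<le> a" and "b \<le> u t1" and "a < b"
  obtains t2 t3 where "t0 \<le> t2" "t2 < t3" "t3 \<le> t1" "u t2 = a" "u t3 = b"
    "\<And>t. t2 \<le> t \<Longrightarrow> t \<le> t3 \<Longrightarrow> a \<le> u t \<and> u t \<le> b"
proof -
  have val: "\<exists>t. x \<le> t \<and> t \<le> y \<and> u t = c"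
    if "t0 \<le> x" "x \<le> y" "y \<le> t1" "u x \<le> c" "c \<le> u y" for x y c
    using IVT'[of u x c y] that continuous_on_subset[OF cont] by (auto simp: subset_iff)
  have level: "compact {t\<in>{x..y}. u t = c}" if "t0 \<le> x" "y \<le> t1" for x y c
  proof -
    have "continuous_on {x..y} u" using continuous_on_subset[OF cont] that by auto
    then have "closed {t\<in>{x..y}. u t = c}"
      using continuous_closed_preimage_constant[of "{x..y}" u c] by simp
    then show ?thesis
      by (rule compact_Int_closed[OF compact_Icc[of x y], THEN back_subst[of compact]]) auto
  qed
  \<comment> \<open>\<open>t3\<close> is the first time at level \<open>b\<close>, and \<open>t2\<close> the last time at level \<open>a\<close> before it.\<close>
  have "{t\<in>{t0..t1}. u t = b} \<noteq> {}" using val[of t0 t1 b] assms by auto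
  from compact_attains_inf[OF level[of t0 t1 b] this]
  obtain t3 where t3: "t0 \<le> t3" "t3 \<le> t1" "u t3 = b"
    and first: "\<And>t. t0 \<le> t \<Longrightarrow> t \<le> t1 \<Longrightarrow> u t = b \<Longrightarrow> t3 \<le> t" by auto
  have "{t\<in>{t0..t3}. u t = a} \<noteq> {}" using val[of t0 t3 a] t3 assms by auto
  from compact_attains_sup[OF level[of t0 t3 a] this] t3
  obtain t2 where t2: "t0 \<le> t2" "t2 \<le> t3" "u t2 = a"
    and last: "\<And>t. t0 \<le> t \<Longrightarrow> t \<le> t3 \<Longrightarrow> u t = a \<Longrightarrow> t \<le> t2" by auto
  have "t2 < t3" using t2 t3 \<open>a < b\<close> by (cases "t2 = t3") auto
  moreover have "a \<le> u t \<and> u t \<le> b" if t: "t2 \<le> t" "t \<le> t3" for t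
  proof (intro conjI; rule ccontr)
    assume "\<not> a \<le> u t"
    then obtain t' where "t \<le> t'" "t' \<le> t3" "u t' = a"
      using val[of t t3 a] t t2 t3 \<open>a < b\<close> by auto
    then have "t = t2" using last[of t'] t t2 by auto
    then show False using \<open>\<not> a \<le> u t\<close> t2 by simp
  next
    assume "\<not> u t \<le> b"
    then obtain t' where "t0 \<le> t'" "t' \<le> t" "u t' = b"
      using val[of t0 t b] t t2 t3 \<open>a < b\<close> \<open>u t0 \<le> a\<close> by auto
    then have "t = t3" using first[of t'] t t3 by auto
    then show False using \<open>\<not> u t \<le> b\<close> t3 by simp
  qed
  ultimately show ?thesis using that t2 t3 by blast
qed

text \<open>The comparison function \<open>W\<close> shadows \<open>u\<close> while \<open>u\<close> lies in \<open>{a..2 * a}\<close>. An ascent of \<open>u\<close> from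
  \<open>a\<close> to \<open>2 * a\<close> costs \<open>B * t0 powr -\<kappa>\<close> for passing from \<open>u\<close> to \<open>W\<close>, the same for passing back, and
  \<open>\<integral> C * t powr (-\<kappa> - 1) dt \<le> C / \<kappa> * t0 powr -\<kappa>\<close> for the growth of \<open>W\<close> itself. If the total is
  less than \<open>a\<close>, the ascent is never completed.\<close>

lemma barrier:
  fixes u W :: "real \<Rightarrow> real"
  assumes "is_interval J" and "J \<subseteq> {0<..}" and cont: "continuous_on J u"
    and "0 < \<kappa>" and "0 < a" and "0 \<le> B" and "0 \<le> C"
    and "t0 \<in> J" and "u t0 \<le> a"
    and close: "\<And>t. t \<in> J \<Longrightarrow> t0 \<le> t \<Longrightarrow> a \<le> u t \<Longrightarrow> u t \<le> 2 * a \<Longrightarrow> \<bar>W t - u t\<bar> \<le> B * t powr - \<kappa>"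
    and rate: "\<And>t. t \<in> J \<Longrightarrow> t0 \<le> t \<Longrightarrow> a \<le> u t \<Longrightarrow> u t \<le> 2 * a \<Longrightarrow>
      \<exists>D. (W has_real_derivative D) (at t within J) \<and> D \<le> C * t powr (- \<kappa> - 1)"
    and large: "(2 * B + C / \<kappa>) * t0 powr - \<kappa> < a"
    and "t1 \<in> J" and "t0 \<le> t1"
  shows "u t1 < 2 * a"
proof (rule ccontr)
  assume "\<not> u t1 < 2 * a"
  have "{t0..t1} \<subseteq> J"
    using mem_is_interval_1_I[OF \<open>is_interval J\<close> \<open>t0 \<in> J\<close> \<open>t1 \<in> J\<close>] by auto
  then have "continuous_on {t0..t1} u" using cont continuous_on_subset by blast
  then obtain t2 t3 where t: "t0 \<le> t2" "t2 < t3" "t3 \<le> t1" "u t2 = a" "u t3 = 2 * a"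
    and between: "\<And>t. t2 \<le> t \<Longrightarrow> t \<le> t3 \<Longrightarrow> a \<le> u t \<and> u t \<le> 2 * a"
    using up_crossing[of t0 t1 u a "2 * a"] \<open>\<not> u t1 < 2 * a\<close> \<open>t0 \<le> t1\<close> \<open>u t0 \<le> a\<close> \<open>0 < a\<close> by auto
  have J: "{t2..t3} \<subseteq> J" using t \<open>{t0..t1} \<subseteq> J\<close> by auto
  have pos: "0 < t0" using \<open>t0 \<in> J\<close> \<open>J \<subseteq> {0<..}\<close> by auto
  \<comment> \<open>The added term is a primitive of minus the bound on the rate, so \<open>Y\<close> cannot increase.\<close>
  define Y where "Y t = W t + C / \<kappa> * t powr - \<kappa>" for t
  have Y': "\<exists>D. (Y has_real_derivative D) (at t within {t2..t3}) \<and> D \<le> 0" if "t2 \<le> t" "t \<le> t3" for t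
  proof -
    have "t \<in> J" "t0 \<le> t" using J that t(1) by auto
    from rate[OF this] between[OF that]
    obtain D where D: "(W has_real_derivative D) (at t within J)" "D \<le> C * t powr (- \<kappa> - 1)" by blast
    have "0 < t" using \<open>t0 \<le> t\<close> pos by linarith
    have "(Y has_real_derivative D + C / \<kappa> * (- \<kappa> * t powr (- \<kappa> - 1))) (at t within {t2..t3})"
      unfolding Y_def using \<open>0 < t\<close>
      by (auto intro!: derivative_eq_intros DERIV_subset[OF D(1) J])
    then show ?thesis using D(2) \<open>0 < \<kappa>\<close> by (intro exI[of _ "D + C / \<kappa> * (- \<kappa> * t powr (- \<kappa> - 1))"]) auto
  qed
  have "Y t3 \<le> Y t2"
  proof (rule DERIV_nonpos_imp_decreasing_open[of t2 t3 Y])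
    show "continuous_on {t2..t3} Y"
      unfolding continuous_on_eq_continuous_within using Y' by (meson DERIV_continuous atLeastAtMost_iff)
    show "\<exists>y. (Y has_real_derivative y) (at x) \<and> y \<le> 0" if "t2 < x" "x < t3" for x
      using Y'[of x] that at_within_Icc_at[of t2 x t3] by auto
  qed (use t in auto)
  moreover have "\<bar>W t2 - u t2\<bar> \<le> B * t0 powr - \<kappa>" "\<bar>W t3 - u t3\<bar> \<le> B * t0 powr - \<kappa>"
    "C / \<kappa> * t2 powr - \<kappa> \<le> C / \<kappa> * t0 powr - \<kappa>" "0 \<le> C / \<kappa> * t3 powr - \<kappa>"
  proof -
    have mono: "x powr - \<kappa> \<le> t0 powr - \<kappa>" if "t0 \<le> x" for x
      using that pos \<open>0 < \<kappa>\<close> by (intro powr_mono2') auto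
    show "\<bar>W t2 - u t2\<bar> \<le> B * t0 powr - \<kappa>"
      using close[of t2] between[of t2] J t mono[of t2] \<open>0 \<le> B\<close>
      by (smt (verit) atLeastAtMost_iff mult_left_mono subsetD)
    show "\<bar>W t3 - u t3\<bar> \<le> B * t0 powr - \<kappa>"
      using close[of t3] between[of t3] J t mono[of t3] \<open>0 \<le> B\<close>
      by (smt (verit) atLeastAtMost_iff mult_left_mono subsetD)
    show "C / \<kappa> * t2 powr - \<kappa> \<le> C / \<kappa> * t0 powr - \<kappa>"
      using mono[of t2] t \<open>0 \<le> C\<close> \<open>0 < \<kappa>\<close> by (intro mult_left_mono) auto
    show "0 \<le> C / \<kappa> * t3 powr - \<kappa>" using \<open>0 \<le> C\<close> \<open>0 < \<kappa>\<close> by simp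
  qed
  ultimately show False using t large unfolding Y_def by (simp add: algebra_simps)
qed

section \<open>Periodic functions on a slab\<close>

lemma periodic2_shift:
  assumes "periodic2 h"
  shows "h (\<phi> + 2 * pi * of_int m) (S + 2 * pi * of_int l) = h \<phi> S"
proof -
  have up: "h (\<phi> + 2 * pi * real m) (S + 2 * pi * real l) = h \<phi> S" for m l :: nat and \<phi> S
  proof (induction m)
    case 0
    show ?case
    proof (induction l)
      case (Suc l)
      have "h \<phi> ((S + 2 * pi * real l) + 2 * pi) = h \<phi> (S + 2 * pi * real l)"
        using assms unfolding periodic2_def by blast
      then show ?case using Suc by (simp add: algebra_simps)
    qed simp
  next
    case (Suc m)
    have "h ((\<phi> + 2 * pi * real m) + 2 * pi) (S + 2 * pi * real l) = h (\<phi> + 2 * pi * real m) (S + 2 * pi * real l)"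
      using assms unfolding periodic2_def by blast
    then show ?case using Suc by (simp add: algebra_simps)
  qed
  have up1: "h (\<phi> + 2 * pi * of_int m) S = h \<phi> S" for m \<phi> S
  proof (cases "m \<ge> 0")
    case True then show ?thesis using up[of \<phi> "nat m" S 0] by simp
  next
    case False then show ?thesis using up[of "\<phi> + 2 * pi * of_int m" "nat (-m)" S 0] by simp
  qed
  have "h \<phi> (S + 2 * pi * of_int l) = h \<phi> S" for l \<phi> S
  proof (cases "l \<ge> 0")
    case True then show ?thesis using up[of \<phi> 0 S "nat l"] by simp
  next
    case False then show ?thesis using up[of \<phi> 0 "S + 2 * pi * of_int l" "nat (-l)"] by simp
  qed
  then show ?thesis using up1 by simp
qed

lemma reduce_angle: "\<exists>m::int. 0 \<le> x + 2 * pi * of_int m \<and> x + 2 * pi * of_int m \<le> 2 * pi"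
proof -
  define y where "y = x / (2 * pi)"
  have x: "x = 2 * pi * y" unfolding y_def by simp
  have "0 \<le> 2 * pi * (y - of_int \<lfloor>y\<rfloor>)" "2 * pi * (y - of_int \<lfloor>y\<rfloor>) \<le> 2 * pi * 1"
    by (simp, intro mult_left_mono) (linarith, simp)
  then show ?thesis unfolding x by (intro exI[of _ "- \<lfloor>y\<rfloor>"]) (simp add: algebra_simps)
qed

text \<open>The slab is not compact, but periodicity reduces both angles to \<open>{0..2 * pi}\<close>.\<close>

lemma periodic_bounded_on_slab:
  fixes h :: "real \<Rightarrow> real \<Rightarrow> real \<Rightarrow> real"
  assumes cont: "continuous_on (slab \<rho>) (\<lambda>(r, \<phi>, S). h r \<phi> S)"
    and per: "\<And>r. \<bar>r\<bar> \<le> \<rho> \<Longrightarrow> periodic2 (h r)"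
  shows "\<exists>B. \<forall>r \<phi> S. \<bar>r\<bar> \<le> \<rho> \<longrightarrow> \<bar>h r \<phi> S\<bar> \<le> B"
proof -
  let ?K = "{-\<rho>..\<rho>} \<times> {0..2*pi} \<times> {0..2*pi}"
  have "compact ((\<lambda>(r, \<phi>, S). h r \<phi> S) ` ?K)"
    by (rule compact_continuous_image[OF continuous_on_subset[OF cont]])
      (auto simp: slab_def intro: compact_Times)
  then obtain B where B: "\<And>y. y \<in> (\<lambda>(r, \<phi>, S). h r \<phi> S) ` ?K \<Longrightarrow> norm y \<le> B"
    using compact_imp_bounded bounded_iff by metis
  have "\<bar>h r \<phi> S\<bar> \<le> B" if r: "\<bar>r\<bar> \<le> \<rho>" for r \<phi> S
  proof -
    obtain m l :: int where "\<phi> + 2 * pi * of_int m \<in> {0..2*pi}" "S + 2 * pi * of_int l \<in> {0..2*pi}"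
      using reduce_angle[of \<phi>] reduce_angle[of S] by auto
    then have "(r, \<phi> + 2 * pi * of_int m, S + 2 * pi * of_int l) \<in> ?K" using r by auto
    from B[OF imageI[OF this]] show ?thesis using periodic2_shift[OF per[OF r]] by simp
  qed
  then show ?thesis by blast
qed

lemma uniform_bound_finite:
  fixes h :: "'i \<Rightarrow> 'x \<Rightarrow> real"
  assumes "finite A" and "\<And>k. k \<in> A \<Longrightarrow> \<exists>B. \<forall>x\<in>X. \<bar>h k x\<bar> \<le> B"
  shows "\<exists>B\<ge>0. \<forall>k\<in>A. \<forall>x\<in>X. \<bar>h k x\<bar> \<le> B"
proof -
  obtain b where b: "\<And>k x. k \<in> A \<Longrightarrow> x \<in> X \<Longrightarrow> \<bar>h k x\<bar> \<le> b k"
    using assms(2) by metis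
  have "\<bar>h k x\<bar> \<le> (\<Sum>k\<in>A. \<bar>b k\<bar>)" if "k \<in> A" "x \<in> X" for k x
    using b[OF that] member_le_sum[OF that(1), of "\<lambda>k. \<bar>b k\<bar>"] \<open>finite A\<close> by auto
  then show ?thesis by (intro exI[of _ "\<Sum>k\<in>A. \<bar>b k\<bar>"]) (auto simp: sum_nonneg)
qed

lemma periodic_family_bounded:
  fixes h :: "nat \<Rightarrow> real \<Rightarrow> real \<Rightarrow> real \<Rightarrow> real"
  assumes "finite A"
    and cont: "\<And>k. k \<in> A \<Longrightarrow> continuous_on (slab \<rho>) (\<lambda>(r, \<phi>, S). h k r \<phi> S)"
    and per: "\<And>k r. k \<in> A \<Longrightarrow> \<bar>r\<bar> \<le> \<rho> \<Longrightarrow> periodic2 (h k r)"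
  shows "\<exists>B\<ge>0. \<forall>k\<in>A. \<forall>r \<phi> S. \<bar>r\<bar> \<le> \<rho> \<longrightarrow> \<bar>h k r \<phi> S\<bar> \<le> B"
proof -
  have "\<exists>B. \<forall>y\<in>slab \<rho>. \<bar>(\<lambda>(r, \<phi>, S). h k r \<phi> S) y\<bar> \<le> B" if "k \<in> A" for k
    using periodic_bounded_on_slab[of \<rho> "h k", OF cont[OF that] per[OF that]] by (auto simp: slab_def)
  then obtain B where "0 \<le> B" and B: "\<forall>k\<in>A. \<forall>y\<in>slab \<rho>. \<bar>(\<lambda>(r, \<phi>, S). h k r \<phi> S) y\<bar> \<le> B"
    using uniform_bound_finite[OF \<open>finite A\<close>, of "slab \<rho>" "\<lambda>k (r, \<phi>, S). h k r \<phi> S"] by blast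
  have "\<bar>h k r \<phi> S\<bar> \<le> B" if "k \<in> A" "\<bar>r\<bar> \<le> \<rho>" for k r \<phi> S
    using B[rule_format, of k "(r, \<phi>, S)"] that by (simp add: slab_def)
  then show ?thesis using \<open>0 \<le> B\<close> by blast
qed

lemma smooth_on_imp_continuous_on: "smooth_on h D \<Longrightarrow> continuous_on D h"
  unfolding smooth_on_def by (metis Ck_on.simps(1))

text \<open>\<open>smooth_on\<close> speaks of derivatives within the closed slab, whereas the averaging formulas use the
  two-sided partial derivatives \<open>deriv\<close>. The two agree in the interior of the slab, which is where
  continuity on a smaller closed slab comes from.\<close>

lemma smooth_slab_partials:
  assumes "smooth_on (\<lambda>(r, \<phi>, S). w r \<phi> S) (slab \<rho>)" and "\<rho>' < \<rho>"
  shows "\<And>r \<phi> S. \<bar>r\<bar> < \<rho> \<Longrightarrow>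
      ((\<lambda>(r, \<phi>, S). w r \<phi> S) has_derivative
        (\<lambda>(a, b, c). a * deriv (\<lambda>x. w x \<phi> S) r + b * deriv (\<lambda>x. w r x S) \<phi> + c * deriv (\<lambda>x. w r \<phi> x) S))
      (at (r, \<phi>, S))"
    and "continuous_on (slab \<rho>') (\<lambda>(r, \<phi>, S). deriv (\<lambda>x. w x \<phi> S) r)"
    and "continuous_on (slab \<rho>') (\<lambda>(r, \<phi>, S). deriv (\<lambda>x. w r x S) \<phi>)"
    and "continuous_on (slab \<rho>') (\<lambda>(r, \<phi>, S). deriv (\<lambda>x. w r \<phi> x) S)"
proof -
  let ?w = "\<lambda>(r, \<phi>, S). w r \<phi> S"
  have "Ck_on (Suc 0) ?w (slab \<rho>)" using assms unfolding smooth_on_def by blast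
  then obtain h' where der: "\<And>x. x \<in> slab \<rho> \<Longrightarrow> (?w has_derivative h' x) (at x within slab \<rho>)"
    and cont: "\<And>e. continuous_on (slab \<rho>) (\<lambda>x. h' x e)" by auto
  have op: "open {(r::real, \<phi>::real, S::real). \<bar>r\<bar> < \<rho>}"
    unfolding case_prod_beta by (intro open_Collect_less continuous_intros)
  have at: "(?w has_derivative h' (r, \<phi>, S)) (at (r, \<phi>, S))" if "\<bar>r\<bar> < \<rho>" for r \<phi> S
  proof -
    have int: "(r, \<phi>, S) \<in> interior (slab \<rho>)"
      using that by (intro interiorI[OF op]) (auto simp: slab_def)
    then have "(r, \<phi>, S) \<in> slab \<rho>" using interior_subset by blast
    from der[OF this] show ?thesis using at_within_interior[OF int] by simp
  qed
  have partials: "h' (r, \<phi>, S) (1, 0, 0) = deriv (\<lambda>x. w x \<phi> S) r"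
    "h' (r, \<phi>, S) (0, 1, 0) = deriv (\<lambda>x. w r x S) \<phi>"
    "h' (r, \<phi>, S) (0, 0, 1) = deriv (\<lambda>x. w r \<phi> x) S"
    if "\<bar>r\<bar> < \<rho>" for r \<phi> S
  proof -
    interpret D: bounded_linear "h' (r, \<phi>, S)" using at[OF that] by (rule has_derivative_bounded_linear)
    have line: "h' (r, \<phi>, S) e = deriv u x" if "(u has_derivative (\<lambda>y. h' (r, \<phi>, S) (y *\<^sub>R e))) (at x)" for u x e
    proof -
      have "(\<lambda>y. h' (r, \<phi>, S) (y *\<^sub>R e)) = (*) (h' (r, \<phi>, S) e)" by (simp add: D.scaleR fun_eq_iff)
      then show ?thesis using that by (simp add: has_field_derivative_def DERIV_imp_deriv)
    qed
    have d1: "((\<lambda>x. ?w (x, \<phi>, S)) has_derivative (\<lambda>x. h' (r, \<phi>, S) (x, 0, 0))) (at r)"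
      by (rule has_derivative_compose[of "\<lambda>x. (x, \<phi>, S)", OF _ at[OF that]])
        (auto intro!: derivative_eq_intros simp: zero_prod_def)
    have d2: "((\<lambda>x. ?w (r, x, S)) has_derivative (\<lambda>x. h' (r, \<phi>, S) (0, x, 0))) (at \<phi>)"
      by (rule has_derivative_compose[of "\<lambda>x. (r, x, S)", OF _ at[OF that]])
        (auto intro!: derivative_eq_intros simp: zero_prod_def)
    have d3: "((\<lambda>x. ?w (r, \<phi>, x)) has_derivative (\<lambda>x. h' (r, \<phi>, S) (0, 0, x))) (at S)"
      by (rule has_derivative_compose[of "\<lambda>x. (r, \<phi>, x)", OF _ at[OF that]])
        (auto intro!: derivative_eq_intros simp: zero_prod_def)
    show "h' (r, \<phi>, S) (1, 0, 0) = deriv (\<lambda>x. w x \<phi> S) r" using d1 by (intro line) simp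
    show "h' (r, \<phi>, S) (0, 1, 0) = deriv (\<lambda>x. w r x S) \<phi>" using d2 by (intro line) simp
    show "h' (r, \<phi>, S) (0, 0, 1) = deriv (\<lambda>x. w r \<phi> x) S" using d3 by (intro line) simp
  qed
  show "(?w has_derivative
        (\<lambda>(a, b, c). a * deriv (\<lambda>x. w x \<phi> S) r + b * deriv (\<lambda>x. w r x S) \<phi> + c * deriv (\<lambda>x. w r \<phi> x) S))
      (at (r, \<phi>, S))" if "\<bar>r\<bar> < \<rho>" for r \<phi> S
  proof -
    interpret D: bounded_linear "h' (r, \<phi>, S)" using at[OF that] by (rule has_derivative_bounded_linear)
    have "h' (r, \<phi>, S) (a, b, c) = a * h' (r, \<phi>, S) (1, 0, 0) + b * h' (r, \<phi>, S) (0, 1, 0)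
        + c * h' (r, \<phi>, S) (0, 0, 1)" for a b c
    proof -
      have "h' (r, \<phi>, S) (a *\<^sub>R (1, 0, 0) + b *\<^sub>R (0, 1, 0) + c *\<^sub>R (0, 0, 1))
          = a * h' (r, \<phi>, S) (1, 0, 0) + b * h' (r, \<phi>, S) (0, 1, 0) + c * h' (r, \<phi>, S) (0, 0, 1)"
        by (simp only: D.add D.scaleR real_scaleR_def)
      then show ?thesis by simp
    qed
    then have "h' (r, \<phi>, S) = (\<lambda>(a, b, c). a * deriv (\<lambda>x. w x \<phi> S) r + b * deriv (\<lambda>x. w r x S) \<phi>
        + c * deriv (\<lambda>x. w r \<phi> x) S)"
      using partials[OF that] by auto
    then show ?thesis using at[OF that, of \<phi> S] by simp
  qed
  have sub: "continuous_on (slab \<rho>') (\<lambda>x. h' x e)" for e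
    by (rule continuous_on_subset[OF cont]) (use \<open>\<rho>' < \<rho>\<close> in \<open>auto simp: slab_def\<close>)
  have eq: "continuous_on (slab \<rho>') (\<lambda>(r, \<phi>, S). d r \<phi> S)"
    if "\<And>r \<phi> S. \<bar>r\<bar> < \<rho> \<Longrightarrow> h' (r, \<phi>, S) e = d r \<phi> S" for d e
    using sub[of e] by (rule continuous_on_eq) (use that \<open>\<rho>' < \<rho>\<close> in \<open>auto simp: slab_def\<close>)
  show "continuous_on (slab \<rho>') (\<lambda>(r, \<phi>, S). deriv (\<lambda>x. w x \<phi> S) r)"
    by (rule eq) (erule partials(1))
  show "continuous_on (slab \<rho>') (\<lambda>(r, \<phi>, S). deriv (\<lambda>x. w r x S) \<phi>)"
    by (rule eq) (erule partials(2))
  show "continuous_on (slab \<rho>') (\<lambda>(r, \<phi>, S). deriv (\<lambda>x. w r \<phi> x) S)"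
    by (rule eq) (erule partials(3))
qed

lemma periodic2_partials:
  assumes per: "\<And>r. \<bar>r\<bar> \<le> \<rho> \<Longrightarrow> periodic2 (w r)" and "\<bar>r\<bar> < \<rho>"
  shows "periodic2 (\<lambda>\<phi> S. deriv (\<lambda>x. w x \<phi> S) r)"
    and "periodic2 (\<lambda>\<phi> S. deriv (\<lambda>x. w r x S) \<phi>)"
    and "periodic2 (\<lambda>\<phi> S. deriv (\<lambda>x. w r \<phi> x) S)"
proof -
  have "\<forall>\<^sub>F x in nhds r. \<bar>x\<bar> < \<rho>"
    using \<open>\<bar>r\<bar> < \<rho>\<close> by (intro eventually_nhds_in_open[of "{x. \<bar>x\<bar> < \<rho>}", simplified]) (auto intro!: open_Collect_less continuous_intros)
  then have "\<forall>\<^sub>F x in nhds r. w x (\<phi> + 2 * pi) S = w x \<phi> S"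
    "\<forall>\<^sub>F x in nhds r. w x \<phi> (S + 2 * pi) = w x \<phi> S" for \<phi> S
    by (auto elim!: eventually_mono simp: per[unfolded periodic2_def])
  then show "periodic2 (\<lambda>\<phi> S. deriv (\<lambda>x. w x \<phi> S) r)"
    unfolding periodic2_def by (auto intro!: deriv_cong_ev)
  have deriv_shift: "deriv u (x + 2 * pi) = deriv (\<lambda>x. u (x + 2 * pi)) x" for u :: "real \<Rightarrow> real" and x
    unfolding deriv_def by (simp add: DERIV_shift)
  have p: "w r (\<phi> + 2 * pi) S = w r \<phi> S" "w r \<phi> (S + 2 * pi) = w r \<phi> S" for \<phi> S
    using per[of r] \<open>\<bar>r\<bar> < \<rho>\<close> by (auto simp: periodic2_def)
  show "periodic2 (\<lambda>\<phi> S. deriv (\<lambda>x. w r x S) \<phi>)" "periodic2 (\<lambda>\<phi> S. deriv (\<lambda>x. w r \<phi> x) S)"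
    unfolding periodic2_def deriv_shift p by auto
qed

section \<open>Derivatives and expansions in time\<close>

lemma phase_has_derivative:
  assumes "q \<ge> 1" and "t > 0"
  shows "(phase q s has_real_derivative
      s 0 + (\<Sum>i = 1..q. t powr (- real i / real q) * phase_rate q s i)) (at t within J)"
proof -
  have "(phase q s has_real_derivative
      s 0 + (\<Sum>k = 1..<q. s k * ((1 - real k / real q) * t powr (1 - real k / real q - 1))) + s q * inverse t)
      (at t within J)"
    unfolding phase_def using assms by (auto intro!: derivative_eq_intros simp: field_simps)
  moreover have "{1..q} = insert q {1..<q}" using \<open>q \<ge> 1\<close> by auto
  then have "(\<Sum>i = 1..q. t powr (- real i / real q) * phase_rate q s i)
      = (\<Sum>k = 1..<q. s k * ((1 - real k / real q) * t powr (1 - real k / real q - 1))) + s q * inverse t"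
    using assms by (auto simp: phase_rate_def powr_minus intro!: sum.cong)
  ultimately show ?thesis by (simp add: add.assoc)
qed

lemma asymptotic_remainder_bound:
  assumes "asymptotic_series q \<rho> h hk"
  obtains C T where "0 \<le> C"
    "\<And>t r \<phi> S. T \<le> t \<Longrightarrow> \<bar>r\<bar> \<le> \<rho> \<Longrightarrow>
       \<bar>h r \<phi> S t - (\<Sum>k = 1..M. t powr (- real k / real q) * hk k r \<phi> S)\<bar>
         \<le> C * t powr (- real (M + 1) / real q)"
proof -
  have "(\<lambda>(t, (r, \<phi>, S)). h r \<phi> S t - (\<Sum>k = 1..M. t powr (- real k / real q) * hk k r \<phi> S))
            \<in> O[at_top \<times>\<^sub>F principal (slab \<rho>)](\<lambda>(t, _). t powr (- real (M + 1) / real q))"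
    using assms unfolding asymptotic_series_def by blast
  then obtain C where "C > 0" and "\<forall>\<^sub>F y in at_top \<times>\<^sub>F principal (slab \<rho>).
      norm ((\<lambda>(t, (r, \<phi>, S)). h r \<phi> S t - (\<Sum>k = 1..M. t powr (- real k / real q) * hk k r \<phi> S)) y)
        \<le> C * norm ((\<lambda>(t, _). t powr (- real (M + 1) / real q)) y)"
    by (rule landau_o.bigE)
  then obtain Q Q' where "eventually Q at_top" and "eventually Q' (principal (slab \<rho>))"
    and Q: "\<And>t y. Q t \<Longrightarrow> Q' y \<Longrightarrow>
      norm ((\<lambda>(t, (r, \<phi>, S)). h r \<phi> S t - (\<Sum>k = 1..M. t powr (- real k / real q) * hk k r \<phi> S)) (t, y))
        \<le> C * norm ((\<lambda>(t, _). t powr (- real (M + 1) / real q)) (t, y))"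
    unfolding eventually_prod_filter by blast
  then obtain T where T: "\<And>t. T \<le> t \<Longrightarrow> Q t" and Q': "\<And>y. y \<in> slab \<rho> \<Longrightarrow> Q' y"
    unfolding eventually_principal eventually_at_top_linorder by blast
  have "\<bar>h r \<phi> S t - (\<Sum>k = 1..M. t powr (- real k / real q) * hk k r \<phi> S)\<bar>
         \<le> C * t powr (- real (M + 1) / real q)" if "T \<le> t" "\<bar>r\<bar> \<le> \<rho>" for t r \<phi> S
    using Q[OF T[OF that(1)] Q'[of "(r, \<phi>, S)"]] that(2) by (simp add: slab_def)
  then show ?thesis using that[of C T] \<open>C > 0\<close> by simp
qed

lemma powr_neg_root:
  assumes "t > 0" and "q \<ge> 1"
  shows "t powr (- real k / real q) = (t powr (- 1 / real q)) ^ k"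
    and "t powr (- real k / real q - 1) = (t powr (- 1 / real q)) ^ (k + q)"
proof -
  have "- real k / real q = real k * (- 1 / real q)" by simp
  then show "t powr (- real k / real q) = (t powr (- 1 / real q)) ^ k"
    using assms by (simp only: powr_power)
  have "- real k / real q - 1 = real (k + q) * (- 1 / real q)" using assms by (simp add: field_simps)
  then show "t powr (- real k / real q - 1) = (t powr (- 1 / real q)) ^ (k + q)"
    using assms by (simp only: powr_power)
qed

lemma V_change_has_derivative:
  assumes smooth: "\<And>k. k \<in> {1..M} \<Longrightarrow> smooth_on (\<lambda>(r, \<phi>, S). v k r \<phi> S) (slab rs)"
    and "\<bar>r t\<bar> < rs" and "t > 0"
    and r: "(r has_real_derivative r') (at t within J)"
    and \<phi>: "(\<phi> has_real_derivative \<phi>') (at t within J)"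
    and S: "(S has_real_derivative S') (at t within J)"
  shows "((\<lambda>t. V_change q S M v (r t) (\<phi> t) t) has_real_derivative
    r' + (\<Sum>k = 1..M. t powr (- real k / real q) *
            (r' * deriv (\<lambda>x. v k x (\<phi> t) (S t)) (r t) + \<phi>' * deriv (\<lambda>x. v k (r t) x (S t)) (\<phi> t)
              + S' * deriv (\<lambda>x. v k (r t) (\<phi> t) x) (S t))
          - real k / real q * t powr (- real k / real q - 1) * v k (r t) (\<phi> t) (S t))) (at t within J)"
proof -
  have inner: "((\<lambda>t. (r t, \<phi> t, S t)) has_derivative (\<lambda>h. (r' * h, \<phi>' * h, S' * h))) (at t within J)"
    using r \<phi> S unfolding has_field_derivative_def by (intro has_derivative_Pair)
  have "((\<lambda>t. v k (r t) (\<phi> t) (S t)) has_real_derivative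
      r' * deriv (\<lambda>x. v k x (\<phi> t) (S t)) (r t) + \<phi>' * deriv (\<lambda>x. v k (r t) x (S t)) (\<phi> t)
              + S' * deriv (\<lambda>x. v k (r t) (\<phi> t) x) (S t)) (at t within J)"
    if "k \<in> {1..M}" for k
    using has_derivative_compose[OF inner smooth_slab_partials(1)[OF smooth[OF that] \<open>\<bar>r t\<bar> < rs\<close> \<open>\<bar>r t\<bar> < rs\<close>]]
    unfolding has_field_derivative_def prod.case by (rule has_derivative_eq_rhs) (auto simp: algebra_simps)
  note [derivative_intros] = this
  show ?thesis
    unfolding V_change_def using r \<open>t > 0\<close>
    by (auto intro!: derivative_eq_intros sum.cong simp: algebra_simps)
qed

section \<open>Cancellation by the homological equations\<close>

text \<open>Up to step \<open>q\<close> the correction \<open>R\<^sub>k\<close> reduces to the convolution sum: the Taylor terms only involve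
  the vanishing \<open>\<Lambda>\<^sub>j\<close> with \<open>j < q\<close>, and differentiating \<open>t powr (-j/q)\<close> produces order
  \<open>t powr (-(j+q)/q)\<close>, which is beyond the order in question.\<close>

lemma R_formula_upto_first_mean:
  assumes "k \<le> q" and "k \<ge> 1" and v0: "v 0 = (\<lambda>r \<phi> S. 0)"
    and zero: "\<And>j \<rho>. 1 \<le> j \<Longrightarrow> j < q \<Longrightarrow> \<bar>\<rho>\<bar> \<le> rs \<Longrightarrow> \<Lambda> j \<rho> = 0"
    and r: "\<bar>r\<bar> < rs"
  shows "R_formula q s fk gk \<Lambda> v k r \<phi> S = - (\<Sum>(i, j) \<in> {(i, j). i + j = k \<and> 1 \<le> i \<and> 1 \<le> j}.
          fk i r \<phi> S * deriv (\<lambda>x. v j x \<phi> S) r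
          + inverse r * gk i r \<phi> S * deriv (\<lambda>x. v j r x S) \<phi>
          + phase_rate q s i * deriv (\<lambda>x. v j r \<phi> x) S)"
proof -
  let ?A = "Abs_fps (\<lambda>i. v i r \<phi> S)"
  let ?term = "\<lambda>j. fps_X ^ j * (fps_compose (taylor_fps (\<Lambda> j) r) ?A - fps_const (\<Lambda> j r))"
  have derivs: "(deriv ^^ m) (\<Lambda> j) x = 0" if "1 \<le> j" "j < q" "\<bar>x\<bar> < rs" for j m x
    using \<open>\<bar>x\<bar> < rs\<close>
  proof (induction m arbitrary: x)
    case 0
    then show ?case using zero that by simp
  next
    case (Suc m)
    have "\<forall>\<^sub>F y in nhds x. \<bar>y\<bar> < rs"
      using Suc.prems by (intro eventually_nhds_in_open[of "{x. \<bar>x\<bar> < rs}", simplified]) (auto intro!: open_Collect_less continuous_intros)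
    then have "\<forall>\<^sub>F y in nhds x. (deriv ^^ m) (\<Lambda> j) y = 0"
      by (rule eventually_mono) (rule Suc.IH)
    then have "deriv ((deriv ^^ m) (\<Lambda> j)) x = deriv (\<lambda>_. 0) x" by (rule deriv_cong_ev) simp
    then show ?case by simp
  qed
  have "fps_nth (?term j) k = 0" if "j \<in> {1..k}" for j
  \<comment> \<open>For \<open>j = k = q\<close> only the constant coefficient of the difference enters, and it cancels.\<close>
  proof (cases "j < q")
    case True
    then have "taylor_fps (\<Lambda> j) r = 0" "\<Lambda> j r = 0"
      using derivs[of j r] zero[of j r] that r by (auto simp: taylor_fps_def fps_eq_iff)
    then show ?thesis by simp
  next
    case False
    then have "j = k" using that \<open>k \<le> q\<close> by auto
    then show ?thesis by (simp add: fps_X_power_mult_nth taylor_fps_def)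
  qed
  then have "fps_nth (\<Sum>j = 1..k. ?term j) k = 0" by (simp add: fps_sum_nth)
  \<comment> \<open>The first factor vanishes for \<open>k = q\<close>, the second one for \<open>k < q\<close>.\<close>
  moreover have "(1 - real k / real q) * v (k - q) r \<phi> S = 0" using assms by (simp add: v0)
  ultimately show ?thesis unfolding R_formula_def by simp
qed

text \<open>The terms of the product with \<open>i + j \<le> q\<close> make up the second sum; each of the remaining ones, at most
  \<open>q\<^sup>2\<close> in number, carries a power of \<open>x\<close> of order at least \<open>q + 1\<close>.\<close>

lemma cauchy_product_tail:
  fixes P :: "nat \<Rightarrow> nat \<Rightarrow> real"
  assumes x: "0 \<le> x" "x \<le> 1" and "0 \<le> B"
    and B: "\<And>i j. i \<in> {1..q} \<Longrightarrow> j \<in> {1..q} \<Longrightarrow> \<bar>P i j\<bar> \<le> B"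
  shows "\<bar>(\<Sum>j = 1..q. \<Sum>i = 1..q. x ^ (i + j) * P i j)
      - (\<Sum>k = 1..q. x ^ k * (\<Sum>(i, j) \<in> {(i, j). i + j = k \<and> 1 \<le> i \<and> 1 \<le> j}. P i j))\<bar>
    \<le> (real q)\<^sup>2 * B * x ^ (q + 1)"
proof -
  let ?I = "{1..q} \<times> {1..q}" and ?T = "\<lambda>(i, j). x ^ (i + j) * P i j"
  define L where "L = {(i, j) \<in> ?I. i + j \<le> q}"
  have L: "L \<subseteq> ?I" unfolding L_def by auto
  then have "finite L" by (rule finite_subset) simp
  have "(\<Sum>j = 1..q. \<Sum>i = 1..q. x ^ (i + j) * P i j) = (\<Sum>i = 1..q. \<Sum>j = 1..q. x ^ (i + j) * P i j)"
    by (rule sum.swap)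
  also have "\<dots> = sum ?T ?I" by (simp add: sum.cartesian_product)
  finally have all: "(\<Sum>j = 1..q. \<Sum>i = 1..q. x ^ (i + j) * P i j) = sum ?T ?I" .
  have "(\<Sum>k = 1..q. x ^ k * (\<Sum>(i, j) \<in> {(i, j). i + j = k \<and> 1 \<le> i \<and> 1 \<le> j}. P i j))
      = (\<Sum>k = 1..q. sum ?T {y \<in> L. (\<lambda>(i, j). i + j) y = k})"
  proof (rule sum.cong[OF refl])
    fix k assume "k \<in> {1..q}"
    then have "{y \<in> L. (\<lambda>(i, j). i + j) y = k} = {(i, j). i + j = k \<and> 1 \<le> i \<and> 1 \<le> j}"
      unfolding L_def by auto
    then show "x ^ k * (\<Sum>(i, j) \<in> {(i, j). i + j = k \<and> 1 \<le> i \<and> 1 \<le> j}. P i j)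
        = sum ?T {y \<in> L. (\<lambda>(i, j). i + j) y = k}"
      by (auto simp: sum_distrib_left intro!: sum.cong)
  qed
  also have "\<dots> = sum ?T L"
    by (rule sum.group) (use \<open>finite L\<close> in \<open>auto simp: L_def\<close>)
  finally have low: "(\<Sum>k = 1..q. x ^ k * (\<Sum>(i, j) \<in> {(i, j). i + j = k \<and> 1 \<le> i \<and> 1 \<le> j}. P i j))
      = sum ?T L" .
  have "sum ?T ?I - sum ?T L = sum ?T (?I - L)" using L \<open>finite L\<close> by (simp add: sum_diff)
  also have "\<bar>\<dots>\<bar> \<le> (\<Sum>y \<in> ?I - L. x ^ (q + 1) * B)"
  proof (rule order_trans[OF sum_abs], rule sum_mono)
    fix y assume "y \<in> ?I - L"
    then obtain i j where y: "y = (i, j)" "i \<in> {1..q}" "j \<in> {1..q}" "q + 1 \<le> i + j"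
      unfolding L_def by (cases y) auto
    have "x ^ (i + j) \<le> x ^ (q + 1)" using y x by (intro power_decreasing) auto
    then have "x ^ (i + j) * \<bar>P i j\<bar> \<le> x ^ (q + 1) * B"
      using B[OF y(2,3)] x by (intro mult_mono) auto
    then show "\<bar>?T y\<bar> \<le> x ^ (q + 1) * B" using y x by (simp add: abs_mult)
  qed
  also have "\<dots> \<le> (\<Sum>y \<in> ?I. x ^ (q + 1) * B)"
    using x \<open>0 \<le> B\<close> by (intro sum_mono2) auto
  also have "\<dots> = (real q)\<^sup>2 * B * x ^ (q + 1)" by (simp add: power2_eq_square)
  finally show ?thesis unfolding all low .
qed

text \<open>The averaging step at one instant of time, as pure algebra with \<open>x = t powr (-1/q)\<close>. The letters
  stand for the rates \<open>r' = F\<close>, \<open>\<phi>' = \<omega> + G\<close>, \<open>S' = Sd\<close> and for the functions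
  \<open>w k = v\<^sub>k\<close> with partial derivatives \<open>a k\<close>, \<open>b k\<close>, \<open>c k\<close>. In each order
  \<open>x^k\<close> with \<open>k \<le> q\<close>, the homological equation trades \<open>fi k + \<omega> * b k + s0 * c k\<close> for
  \<open>L k + R k\<close>, and \<open>R k\<close> was designed to cancel the products of order \<open>x^k\<close>.\<close>

lemma averaged_rate_algebra:
  fixes fi gi \<sigma> a b c w L R :: "nat \<Rightarrow> real" and x F G \<omega> s0 Sd ef eg :: real
  assumes x: "0 \<le> x" "x \<le> 1" and nonneg: "0 \<le> E" "0 \<le> B" "0 \<le> P"
    and F: "F = (\<Sum>i = 1..q. x ^ i * fi i) + ef" and ef: "\<bar>ef\<bar> \<le> E * x ^ (q + 1)"
    and G: "G = (\<Sum>i = 1..q. x ^ i * gi i) + eg" and eg: "\<bar>eg\<bar> \<le> E * x ^ (q + 1)"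
    and Sd: "Sd = s0 + (\<Sum>i = 1..q. x ^ i * \<sigma> i)"
    and hom: "\<And>k. k \<in> {1..q} \<Longrightarrow> \<omega> * b k + s0 * c k = L k - fi k + R k"
    and R: "\<And>k. k \<in> {1..q} \<Longrightarrow> R k = - (\<Sum>(i, j) \<in> {(i, j). i + j = k \<and> 1 \<le> i \<and> 1 \<le> j}.
        fi i * a j + gi i * b j + \<sigma> i * c j)"
    and B: "\<And>k. k \<in> {1..q} \<Longrightarrow> \<bar>a k\<bar> \<le> B \<and> \<bar>b k\<bar> \<le> B \<and> \<bar>w k\<bar> \<le> B"
    and P: "\<And>i j. i \<in> {1..q} \<Longrightarrow> j \<in> {1..q} \<Longrightarrow> \<bar>fi i * a j + gi i * b j + \<sigma> i * c j\<bar> \<le> P"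
  shows "\<bar>F + (\<Sum>k = 1..q. x ^ k * (F * a k + (\<omega> + G) * b k + Sd * c k) - real k / real q * x ^ (k + q) * w k)
      - (\<Sum>k = 1..q. x ^ k * L k)\<bar> \<le> (E + 2 * real q * E * B + (real q)\<^sup>2 * P + real q * B) * x ^ (q + 1)"
proof -
  let ?P = "\<lambda>i j. fi i * a j + gi i * b j + \<sigma> i * c j"
  let ?Q = "\<Sum>j = 1..q. \<Sum>i = 1..q. x ^ (i + j) * ?P i j"
  \<comment> \<open>The homological equation eliminates \<open>\<omega>\<close> and \<open>s0\<close>, leaving products of series and remainders.\<close>
  have per_step: "x ^ k * (F * a k + (\<omega> + G) * b k + Sd * c k)
      = x ^ k * L k - x ^ k * fi k + x ^ k * R k + (\<Sum>i = 1..q. x ^ (i + k) * ?P i k) + x ^ k * (ef * a k + eg * b k)"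
    if "k \<in> {1..q}" for k
  proof -
    have "F * a k + (\<omega> + G) * b k + Sd * c k
        = (\<omega> * b k + s0 * c k) + ((\<Sum>i = 1..q. x ^ i * fi i) * a k + (\<Sum>i = 1..q. x ^ i * gi i) * b k
            + (\<Sum>i = 1..q. x ^ i * \<sigma> i) * c k) + (ef * a k + eg * b k)"
      unfolding F G Sd by (simp add: algebra_simps)
    also have "(\<Sum>i = 1..q. x ^ i * fi i) * a k + (\<Sum>i = 1..q. x ^ i * gi i) * b k
            + (\<Sum>i = 1..q. x ^ i * \<sigma> i) * c k = (\<Sum>i = 1..q. x ^ i * ?P i k)"
      unfolding sum_distrib_right sum.distrib[symmetric] by (intro sum.cong) (auto simp: algebra_simps)
    finally have bracket: "F * a k + (\<omega> + G) * b k + Sd * c k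
        = (L k - fi k + R k) + (\<Sum>i = 1..q. x ^ i * ?P i k) + (ef * a k + eg * b k)"
      unfolding hom[OF that] .
    have double: "(\<Sum>i = 1..q. x ^ (i + k) * ?P i k) = x ^ k * (\<Sum>i = 1..q. x ^ i * ?P i k)"
      unfolding sum_distrib_left by (intro sum.cong) (auto simp: power_add)
    show ?thesis unfolding bracket double by (simp only: distrib_left right_diff_distrib)
  qed
  have "F + (\<Sum>k = 1..q. x ^ k * (F * a k + (\<omega> + G) * b k + Sd * c k) - real k / real q * x ^ (k + q) * w k)
      - (\<Sum>k = 1..q. x ^ k * L k)
      = F + ((\<Sum>k = 1..q. x ^ k * L k) - (\<Sum>k = 1..q. x ^ k * fi k) + (\<Sum>k = 1..q. x ^ k * R k) + ?Q
          + (\<Sum>k = 1..q. x ^ k * (ef * a k + eg * b k)))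
        - (\<Sum>k = 1..q. real k / real q * x ^ (k + q) * w k) - (\<Sum>k = 1..q. x ^ k * L k)"
    by (simp only: per_step sum.distrib sum_subtractf cong: sum.cong)
  also have "\<dots> = ef + (?Q + (\<Sum>k = 1..q. x ^ k * R k)) + (\<Sum>k = 1..q. x ^ k * (ef * a k + eg * b k))
        - (\<Sum>k = 1..q. real k / real q * x ^ (k + q) * w k)"
    unfolding F by simp
  also have "(\<Sum>k = 1..q. x ^ k * R k)
      = - (\<Sum>k = 1..q. x ^ k * (\<Sum>(i, j) \<in> {(i, j). i + j = k \<and> 1 \<le> i \<and> 1 \<le> j}. ?P i j))"
    unfolding sum_negf[symmetric] by (intro sum.cong) (auto simp: R)
  finally have id: "F + (\<Sum>k = 1..q. x ^ k * (F * a k + (\<omega> + G) * b k + Sd * c k) - real k / real q * x ^ (k + q) * w k)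
      - (\<Sum>k = 1..q. x ^ k * L k)
      = ef + (?Q - (\<Sum>k = 1..q. x ^ k * (\<Sum>(i, j) \<in> {(i, j). i + j = k \<and> 1 \<le> i \<and> 1 \<le> j}. ?P i j)))
        + (\<Sum>k = 1..q. x ^ k * (ef * a k + eg * b k)) - (\<Sum>k = 1..q. real k / real q * x ^ (k + q) * w k)"
    by simp
  \<comment> \<open>Each of the four summands on the right is of order \<open>x ^ (q + 1)\<close>.\<close>
  have tail: "\<bar>?Q - (\<Sum>k = 1..q. x ^ k * (\<Sum>(i, j) \<in> {(i, j). i + j = k \<and> 1 \<le> i \<and> 1 \<le> j}. ?P i j))\<bar>
      \<le> (real q)\<^sup>2 * P * x ^ (q + 1)"
    by (rule cauchy_product_tail[where P = ?P]) (use x nonneg P in auto)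
  have sum_le: "\<bar>\<Sum>k = 1..q. h k\<bar> \<le> real q * M" if "\<And>k. k \<in> {1..q} \<Longrightarrow> \<bar>h k\<bar> \<le> M" for h :: "nat \<Rightarrow> real" and M
    using order_trans[OF sum_abs sum_mono, of "{1..q}" h "\<lambda>_. M"] that by simp
  have "\<bar>\<Sum>k = 1..q. x ^ k * (ef * a k + eg * b k)\<bar> \<le> real q * (2 * (E * x ^ (q + 1) * B))"
  proof (rule sum_le)
    fix k assume k: "k \<in> {1..q}"
    have "\<bar>x ^ k * (ef * a k + eg * b k)\<bar> \<le> 1 * \<bar>ef * a k + eg * b k\<bar>"
      unfolding abs_mult using x by (intro mult_right_mono) (auto simp: power_le_one)
    also have "\<dots> \<le> \<bar>ef\<bar> * \<bar>a k\<bar> + \<bar>eg\<bar> * \<bar>b k\<bar>" by (metis abs_mult abs_triangle_ineq mult_1)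
    also have "\<dots> \<le> E * x ^ (q + 1) * B + E * x ^ (q + 1) * B"
      using ef eg B[OF k] nonneg x by (intro add_mono mult_mono) auto
    finally show "\<bar>x ^ k * (ef * a k + eg * b k)\<bar> \<le> 2 * (E * x ^ (q + 1) * B)" by (simp add: mult_ac)
  qed
  moreover have "\<bar>\<Sum>k = 1..q. real k / real q * x ^ (k + q) * w k\<bar> \<le> real q * (1 * x ^ (q + 1) * B)"
  proof (rule sum_le)
    fix k assume k: "k \<in> {1..q}"
    have "x ^ (k + q) \<le> x ^ (q + 1)" using k x by (intro power_decreasing) auto
    then have "real k / real q * x ^ (k + q) * \<bar>w k\<bar> \<le> 1 * x ^ (q + 1) * B"
      using B[OF k] nonneg x k by (intro mult_mono) auto
    then show "\<bar>real k / real q * x ^ (k + q) * w k\<bar> \<le> 1 * x ^ (q + 1) * B"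
      using x by (simp add: abs_mult)
  qed
  ultimately show ?thesis unfolding id using ef tail by (simp add: algebra_simps)
qed

section \<open>The averaged equation on an annulus\<close>

text \<open>The lower bound \<open>a\<close> on \<open>\<bar>r\<bar>\<close> controls \<open>g / r\<close>, and the upper bound \<open>b < rs\<close> keeps the solution in
  the interior of the slab, where the functions \<open>v\<^sub>k\<close> have two-sided derivatives. The constants do not depend
  on the solution, because the
  coefficients are bounded by periodicity and the asymptotic series hold uniformly on the slab.\<close>

lemma averaging_on_annulus:
  assumes "q \<ge> 1" and "q \<le> N" and "rs < r0"
    and f: "asymptotic_series q r0 f fk" and g: "asymptotic_series q r0 g gk"
    and smooth: "\<forall>k\<ge>1. smooth_on (\<lambda>(r, \<phi>, S). fk k r \<phi> S) (slab r0) \<and>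
                smooth_on (\<lambda>(r, \<phi>, S). gk k r \<phi> S) (slab r0)"
    and per: "\<forall>k\<ge>1. \<forall>r. \<bar>r\<bar> \<le> r0 \<longrightarrow> periodic2 (fk k r) \<and> periodic2 (gk k r)"
    and avg: "averaging_construction q s \<omega> fk gk N rs \<Lambda> v R"
    and zero: "\<And>j \<rho>. 1 \<le> j \<Longrightarrow> j < q \<Longrightarrow> \<bar>\<rho>\<bar> \<le> rs \<Longrightarrow> \<Lambda> j \<rho> = 0"
    and "0 < a" and "b < rs"
  obtains B C T where "0 \<le> B" "0 \<le> C" "1 \<le> T"
    "\<And>J r \<phi> t. solution_on r0 \<omega> f g (phase q s) J r \<phi> \<Longrightarrow> t \<in> J \<Longrightarrow> T \<le> t \<Longrightarrow>
      a \<le> \<bar>r t\<bar> \<Longrightarrow> \<bar>r t\<bar> \<le> b \<Longrightarrow>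
      \<bar>V_change q (phase q s) q v (r t) (\<phi> t) t - r t\<bar> \<le> B * t powr - (1 / real q) \<and>
      (\<exists>D. ((\<lambda>t. V_change q (phase q s) q v (r t) (\<phi> t) t) has_real_derivative D) (at t within J) \<and>
           \<bar>D - \<Lambda> q (r t) / t\<bar> \<le> C * t powr (- (1 / real q) - 1))"
proof -
  have sub: "continuous_on (slab b) h" if "smooth_on h (slab r0)" for h :: "real \<times> real \<times> real \<Rightarrow> real"
    by (rule continuous_on_subset[OF smooth_on_imp_continuous_on[OF that]])
      (use \<open>b < rs\<close> \<open>rs < r0\<close> in \<open>auto simp: slab_def\<close>)
  have v: "smooth_on (\<lambda>(r, \<phi>, S). v k r \<phi> S) (slab rs)" "\<And>r. \<bar>r\<bar> \<le> rs \<Longrightarrow> periodic2 (v k r)"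
    if "k \<in> {1..q}" for k
    using avg that \<open>q \<le> N\<close> unfolding averaging_construction_def by auto
  have small: "\<bar>r\<bar> \<le> b \<Longrightarrow> \<bar>r\<bar> < rs" for r using \<open>b < rs\<close> by linarith
  have "\<exists>B\<ge>0. \<forall>k\<in>{1..q}. \<forall>r \<phi> S. \<bar>r\<bar> \<le> b \<longrightarrow> \<bar>fk k r \<phi> S\<bar> \<le> B"
    by (rule periodic_family_bounded) (use smooth per sub \<open>b < rs\<close> \<open>rs < r0\<close> in auto)
  then obtain Bf where Bf: "0 \<le> Bf" "\<And>k r \<phi> S. k \<in> {1..q} \<Longrightarrow> \<bar>r\<bar> \<le> b \<Longrightarrow> \<bar>fk k r \<phi> S\<bar> \<le> Bf"
    by blast
  have "\<exists>B\<ge>0. \<forall>k\<in>{1..q}. \<forall>r \<phi> S. \<bar>r\<bar> \<le> b \<longrightarrow> \<bar>gk k r \<phi> S\<bar> \<le> B"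
    by (rule periodic_family_bounded) (use smooth per sub \<open>b < rs\<close> \<open>rs < r0\<close> in auto)
  then obtain Bg where Bg: "0 \<le> Bg" "\<And>k r \<phi> S. k \<in> {1..q} \<Longrightarrow> \<bar>r\<bar> \<le> b \<Longrightarrow> \<bar>gk k r \<phi> S\<bar> \<le> Bg"
    by blast
  have v_cont: "continuous_on (slab b) (\<lambda>(r, \<phi>, S). v k r \<phi> S)" if "k \<in> {1..q}" for k
    by (rule continuous_on_subset[OF smooth_on_imp_continuous_on[OF v(1)[OF that]]])
      (use \<open>b < rs\<close> in \<open>auto simp: slab_def\<close>)
  have "\<exists>B\<ge>0. \<forall>k\<in>{1..q}. \<forall>r \<phi> S. \<bar>r\<bar> \<le> b \<longrightarrow> \<bar>v k r \<phi> S\<bar> \<le> B"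
    by (rule periodic_family_bounded) (use v_cont v(2) small in \<open>auto simp: less_imp_le\<close>)
  then obtain B0 where B0: "0 \<le> B0" "\<And>k r \<phi> S. k \<in> {1..q} \<Longrightarrow> \<bar>r\<bar> \<le> b \<Longrightarrow> \<bar>v k r \<phi> S\<bar> \<le> B0"
    by blast
  have d_cont: "continuous_on (slab b) (\<lambda>(r, \<phi>, S). deriv (\<lambda>x. v k x \<phi> S) r)"
    "continuous_on (slab b) (\<lambda>(r, \<phi>, S). deriv (\<lambda>x. v k r x S) \<phi>)"
    "continuous_on (slab b) (\<lambda>(r, \<phi>, S). deriv (\<lambda>x. v k r \<phi> x) S)"
    if "k \<in> {1..q}" for k
    using smooth_slab_partials(2-4)[OF v(1)[OF that] \<open>b < rs\<close>] .
  have d_per: "periodic2 (\<lambda>\<phi> S. deriv (\<lambda>x. v k x \<phi> S) r)"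
    "periodic2 (\<lambda>\<phi> S. deriv (\<lambda>x. v k r x S) \<phi>)"
    "periodic2 (\<lambda>\<phi> S. deriv (\<lambda>x. v k r \<phi> x) S)"
    if "k \<in> {1..q}" "\<bar>r\<bar> \<le> b" for k r
    using periodic2_partials[where w = "v k" and \<rho> = rs, OF v(2)[OF that(1)] small[OF that(2)]]
    by simp_all
  have "\<exists>B\<ge>0. \<forall>k\<in>{1..q}. \<forall>r \<phi> S. \<bar>r\<bar> \<le> b \<longrightarrow> \<bar>deriv (\<lambda>x. v k x \<phi> S) r\<bar> \<le> B"
    by (rule periodic_family_bounded) (simp, erule d_cont(1), erule (1) d_per(1))
  then obtain B1 where B1: "0 \<le> B1" "\<And>k r \<phi> S. k \<in> {1..q} \<Longrightarrow> \<bar>r\<bar> \<le> b \<Longrightarrow> \<bar>deriv (\<lambda>x. v k x \<phi> S) r\<bar> \<le> B1"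
    by blast
  have "\<exists>B\<ge>0. \<forall>k\<in>{1..q}. \<forall>r \<phi> S. \<bar>r\<bar> \<le> b \<longrightarrow> \<bar>deriv (\<lambda>x. v k r x S) \<phi>\<bar> \<le> B"
    by (rule periodic_family_bounded) (simp, erule d_cont(2), erule (1) d_per(2))
  then obtain B2 where B2: "0 \<le> B2" "\<And>k r \<phi> S. k \<in> {1..q} \<Longrightarrow> \<bar>r\<bar> \<le> b \<Longrightarrow> \<bar>deriv (\<lambda>x. v k r x S) \<phi>\<bar> \<le> B2"
    by blast
  have "\<exists>B\<ge>0. \<forall>k\<in>{1..q}. \<forall>r \<phi> S. \<bar>r\<bar> \<le> b \<longrightarrow> \<bar>deriv (\<lambda>x. v k r \<phi> x) S\<bar> \<le> B"
    by (rule periodic_family_bounded) (simp, erule d_cont(3), erule (1) d_per(3))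
  then obtain B3 where B3: "0 \<le> B3" "\<And>k r \<phi> S. k \<in> {1..q} \<Longrightarrow> \<bar>r\<bar> \<le> b \<Longrightarrow> \<bar>deriv (\<lambda>x. v k r \<phi> x) S\<bar> \<le> B3"
    by blast
  obtain B\<sigma> where B\<sigma>: "0 \<le> B\<sigma>" "\<And>i. i \<in> {1..q} \<Longrightarrow> \<bar>phase_rate q s i\<bar> \<le> B\<sigma>"
    using uniform_bound_finite[of "{1..q}" "{()}" "\<lambda>i _. phase_rate q s i"] by blast
  obtain Cf Tf where Cf: "0 \<le> Cf" "\<And>t r \<phi> S. Tf \<le> t \<Longrightarrow> \<bar>r\<bar> \<le> r0 \<Longrightarrow>
       \<bar>f r \<phi> S t - (\<Sum>k = 1..q. t powr (- real k / real q) * fk k r \<phi> S)\<bar> \<le> Cf * t powr (- real (q + 1) / real q)"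
    using asymptotic_remainder_bound[OF f, where M = q] by blast
  obtain Cg Tg where Cg: "0 \<le> Cg" "\<And>t r \<phi> S. Tg \<le> t \<Longrightarrow> \<bar>r\<bar> \<le> r0 \<Longrightarrow>
       \<bar>g r \<phi> S t - (\<Sum>k = 1..q. t powr (- real k / real q) * gk k r \<phi> S)\<bar> \<le> Cg * t powr (- real (q + 1) / real q)"
    using asymptotic_remainder_bound[OF g, where M = q] by blast
  \<comment> \<open>The quotient by \<open>a\<close> bounds the contributions of \<open>g / r\<close>.\<close>
  define E where "E = max Cf (Cg / a)"
  define B where "B = B0 + B1 + B2"
  define P where "P = Bf * B1 + Bg / a * B2 + B\<sigma> * B3"
  define C where "C = E + 2 * real q * E * B + (real q)\<^sup>2 * P + real q * B"
  have nonneg: "0 \<le> E" "0 \<le> B" "0 \<le> P"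
    unfolding E_def B_def P_def using Cf Cg Bf Bg B0 B1 B2 B3 B\<sigma> \<open>0 < a\<close> by auto
  show ?thesis
  proof (rule that[of "real q * B0" C "max 1 (max Tf Tg)"], goal_cases)
    case (4 J r \<phi> t)
    \<comment> \<open>The small parameter in which all series are expanded.\<close>
    define x where "x = t powr (- 1 / real q)"
    let ?r = "r t" and ?\<phi> = "\<phi> t" and ?S = "phase q s t"
    have t: "1 \<le> t" "Tf \<le> t" "Tg \<le> t" "0 < t" using 4 by auto
    have x: "0 \<le> x" "x \<le> 1"
      unfolding x_def using t \<open>q \<ge> 1\<close> powr_mono[of "- 1 / real q" 0 t] by auto
    have pw: "t powr (- real k / real q) = x ^ k" "t powr (- real k / real q - 1) = x ^ (k + q)" for k
      unfolding x_def using powr_neg_root[OF \<open>0 < t\<close> \<open>q \<ge> 1\<close>] by auto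
    have x1: "t powr - (1 / real q) = x" "t powr (- (1 / real q) - 1) = x ^ (q + 1)"
      using pw[of 1] by (auto simp: add.commute)
    have xq: "x ^ q = 1 / t" using pw(1)[of q] \<open>q \<ge> 1\<close> t by (simp add: powr_minus_divide)
    have r: "\<bar>?r\<bar> \<le> b" "\<bar>?r\<bar> < rs" "\<bar>?r\<bar> \<le> rs" "\<bar>?r\<bar> \<le> r0" "0 < \<bar>?r\<bar>" "?r \<noteq> 0"
      using 4 \<open>b < rs\<close> \<open>rs < r0\<close> \<open>0 < a\<close> by auto
    have inv: "\<bar>inverse ?r\<bar> \<le> 1 / a"
      using 4 \<open>0 < a\<close> by (simp add: abs_inverse inverse_eq_divide frac_le)
    define F where "F = f ?r ?\<phi> ?S t"
    define G where "G = inverse ?r * g ?r ?\<phi> ?S t"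
    define Sd where "Sd = s 0 + (\<Sum>i = 1..q. x ^ i * phase_rate q s i)"
    have sol: "(r has_real_derivative F) (at t within J)" "(\<phi> has_real_derivative \<omega> ?r + G) (at t within J)"
      using 4 r unfolding solution_on_def F_def G_def by auto
    have Sder: "(phase q s has_real_derivative Sd) (at t within J)"
      using phase_has_derivative[OF \<open>q \<ge> 1\<close> \<open>0 < t\<close>, of s J] unfolding Sd_def pw .
    have near: "\<bar>V_change q (phase q s) q v ?r ?\<phi> t - ?r\<bar> \<le> real q * B0 * t powr - (1 / real q)"
    proof -
      have "\<bar>\<Sum>k = 1..q. x ^ k * v k ?r ?\<phi> ?S\<bar> \<le> (\<Sum>k = 1..q. x * B0)"
      proof (rule order_trans[OF sum_abs], rule sum_mono)
        fix k assume k: "k \<in> {1..q}"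
        have "x ^ k \<le> x ^ 1" using k x by (intro power_decreasing) auto
        then show "\<bar>x ^ k * v k ?r ?\<phi> ?S\<bar> \<le> x * B0"
          using B0(2)[OF k r(1)] x unfolding abs_mult by (intro mult_mono) auto
      qed
      then show ?thesis unfolding V_change_def pw x1 by (simp add: mult_ac)
    qed
    let ?D = "F + (\<Sum>k = 1..q. x ^ k * (F * deriv (\<lambda>x. v k x ?\<phi> ?S) ?r + (\<omega> ?r + G) * deriv (\<lambda>x. v k ?r x ?S) ?\<phi>
              + Sd * deriv (\<lambda>x. v k ?r ?\<phi> x) ?S) - real k / real q * x ^ (k + q) * v k ?r ?\<phi> ?S)"
    have der: "((\<lambda>t. V_change q (phase q s) q v (r t) (\<phi> t) t) has_real_derivative ?D) (at t within J)"
      using V_change_has_derivative[where r = r and \<phi> = \<phi> and t = t and M = q and q = q, OF v(1) r(2) \<open>0 < t\<close> sol Sder]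
      unfolding pw .
    have "\<bar>?D - (\<Sum>k = 1..q. x ^ k * \<Lambda> k ?r)\<bar> \<le> C * x ^ (q + 1)"
      unfolding C_def
    proof (rule averaged_rate_algebra[where
          fi = "\<lambda>k. fk k ?r ?\<phi> ?S" and gi = "\<lambda>k. inverse ?r * gk k ?r ?\<phi> ?S" and \<sigma> = "phase_rate q s"
          and R = "\<lambda>k. R k ?r ?\<phi> ?S"
          and ef = "F - (\<Sum>i = 1..q. x ^ i * fk i ?r ?\<phi> ?S)"
          and eg = "G - (\<Sum>i = 1..q. x ^ i * (inverse ?r * gk i ?r ?\<phi> ?S))"])
      show "\<bar>F - (\<Sum>i = 1..q. x ^ i * fk i ?r ?\<phi> ?S)\<bar> \<le> E * x ^ (q + 1)"
        using Cf(2)[OF t(2) r(4), of ?\<phi> ?S] mult_right_mono[of Cf E "x ^ (q + 1)"] x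
        unfolding F_def pw E_def by auto
      have "\<bar>G - (\<Sum>i = 1..q. x ^ i * (inverse ?r * gk i ?r ?\<phi> ?S))\<bar>
          = \<bar>inverse ?r\<bar> * \<bar>g ?r ?\<phi> ?S t - (\<Sum>i = 1..q. x ^ i * gk i ?r ?\<phi> ?S)\<bar>"
        unfolding G_def abs_mult[symmetric] by (simp add: right_diff_distrib sum_distrib_left mult_ac)
      also have "\<dots> \<le> 1 / a * (Cg * x ^ (q + 1))"
        using inv Cg(2)[OF t(3) r(4), of ?\<phi> ?S] \<open>0 < a\<close> unfolding pw by (intro mult_mono) auto
      also have "\<dots> \<le> E * x ^ (q + 1)"
        using mult_right_mono[of "Cg / a" E "x ^ (q + 1)"] x unfolding E_def by auto
      finally show "\<bar>G - (\<Sum>i = 1..q. x ^ i * (inverse ?r * gk i ?r ?\<phi> ?S))\<bar> \<le> E * x ^ (q + 1)" .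
      show "\<omega> ?r * deriv (\<lambda>x. v k ?r x ?S) ?\<phi> + s 0 * deriv (\<lambda>x. v k ?r ?\<phi> x) ?S
          = \<Lambda> k ?r - fk k ?r ?\<phi> ?S + R k ?r ?\<phi> ?S" if "k \<in> {1..q}" for k
        using avg that \<open>q \<le> N\<close> r unfolding averaging_construction_def homological_rhs_def by auto
      show "R k ?r ?\<phi> ?S = - (\<Sum>(i, j) \<in> {(i, j). i + j = k \<and> 1 \<le> i \<and> 1 \<le> j}.
          fk i ?r ?\<phi> ?S * deriv (\<lambda>x. v j x ?\<phi> ?S) ?r + inverse ?r * gk i ?r ?\<phi> ?S * deriv (\<lambda>x. v j ?r x ?S) ?\<phi>
          + phase_rate q s i * deriv (\<lambda>x. v j ?r ?\<phi> x) ?S)" if k: "k \<in> {1..q}" for k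
      proof -
        have "R k ?r ?\<phi> ?S = R_formula q s fk gk \<Lambda> v k ?r ?\<phi> ?S" "v 0 = (\<lambda>r \<phi> S. 0)"
          using avg k \<open>q \<le> N\<close> r unfolding averaging_construction_def by auto
        then show ?thesis
          using R_formula_upto_first_mean[of k q v rs \<Lambda>, OF _ _ _ zero r(2)] k by simp
      qed
      show "\<bar>deriv (\<lambda>x. v k x ?\<phi> ?S) ?r\<bar> \<le> B \<and> \<bar>deriv (\<lambda>x. v k ?r x ?S) ?\<phi>\<bar> \<le> B \<and> \<bar>v k ?r ?\<phi> ?S\<bar> \<le> B"
        if "k \<in> {1..q}" for k
        using B0(1) B1(1) B2(1) B0(2)[OF that r(1), of ?\<phi> ?S] B1(2)[OF that r(1), of ?\<phi> ?S]
          B2(2)[OF that r(1), of ?S ?\<phi>] unfolding B_def by linarith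
      show "\<bar>fk i ?r ?\<phi> ?S * deriv (\<lambda>x. v j x ?\<phi> ?S) ?r + inverse ?r * gk i ?r ?\<phi> ?S * deriv (\<lambda>x. v j ?r x ?S) ?\<phi>
          + phase_rate q s i * deriv (\<lambda>x. v j ?r ?\<phi> x) ?S\<bar> \<le> P" if i: "i \<in> {1..q}" and j: "j \<in> {1..q}" for i j
      proof -
        have "\<bar>inverse ?r * gk i ?r ?\<phi> ?S\<bar> \<le> 1 / a * Bg"
          unfolding abs_mult using inv Bg(2)[OF i r(1)] \<open>0 < a\<close> by (intro mult_mono) auto
        then have "\<bar>inverse ?r * gk i ?r ?\<phi> ?S * deriv (\<lambda>x. v j ?r x ?S) ?\<phi>\<bar> \<le> Bg / a * B2"
          unfolding abs_mult[of _ "deriv _ _"] using B2(2)[OF j r(1)] Bg(1) \<open>0 < a\<close> by (intro mult_mono) auto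
        moreover have "\<bar>fk i ?r ?\<phi> ?S * deriv (\<lambda>x. v j x ?\<phi> ?S) ?r\<bar> \<le> Bf * B1"
          unfolding abs_mult using Bf(2)[OF i r(1)] B1(2)[OF j r(1)] Bf(1) by (intro mult_mono) auto
        moreover have "\<bar>phase_rate q s i * deriv (\<lambda>x. v j ?r ?\<phi> x) ?S\<bar> \<le> B\<sigma> * B3"
          unfolding abs_mult using B\<sigma>(2)[OF i] B3(2)[OF j r(1)] B\<sigma>(1) by (intro mult_mono) auto
        ultimately show ?thesis unfolding P_def by linarith
      qed
    qed (use x nonneg in \<open>auto simp: Sd_def\<close>)
    moreover have "(\<Sum>k = 1..q. x ^ k * \<Lambda> k ?r) = \<Lambda> q ?r / t"
    proof -
      have "{1..q} = insert q {1..<q}" using \<open>q \<ge> 1\<close> by auto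
      then show ?thesis using zero r xq by simp
    qed
    ultimately show ?case using near der unfolding x1 by auto
  qed (use nonneg B0 in \<open>auto simp: C_def\<close>)
qed

section \<open>Stability\<close>

theorem theorem4:
  fixes r0 rs ts lam :: real and q p N n :: nat
    and \<omega> :: "real \<Rightarrow> real"
    and f g :: "real \<Rightarrow> real \<Rightarrow> real \<Rightarrow> real \<Rightarrow> real"
    and fk gk :: "nat \<Rightarrow> real \<Rightarrow> real \<Rightarrow> real \<Rightarrow> real"
    and s :: "nat \<Rightarrow> real"
    and \<Lambda> :: "nat \<Rightarrow> real \<Rightarrow> real"
    and v R :: "nat \<Rightarrow> real \<Rightarrow> real \<Rightarrow> real \<Rightarrow> real"
  assumes "r0 > 0" and "q \<ge> 1"
    and "smooth_on \<omega> {- r0..r0}" and "\<forall>r. \<bar>r\<bar> \<le> r0 \<longrightarrow> \<omega> r > 0"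
    and "smooth_on (\<lambda>(r, \<phi>, S, t). f r \<phi> S t) {(r, \<phi>, S, t). \<bar>r\<bar> \<le> r0 \<and> 0 < t}"
    and "smooth_on (\<lambda>(r, \<phi>, S, t). g r \<phi> S t) {(r, \<phi>, S, t). \<bar>r\<bar> \<le> r0 \<and> 0 < t}"
    and "\<forall>r t. \<bar>r\<bar> \<le> r0 \<and> 0 < t \<longrightarrow>
           periodic2 (\<lambda>\<phi> S. f r \<phi> S t) \<and> periodic2 (\<lambda>\<phi> S. g r \<phi> S t)"
    and "asymptotic_series q r0 f fk" and "asymptotic_series q r0 g gk"
    and "\<forall>k\<ge>1. smooth_on (\<lambda>(r, \<phi>, S). fk k r \<phi> S) (slab r0) \<and>
                smooth_on (\<lambda>(r, \<phi>, S). gk k r \<phi> S) (slab r0)"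
    and "\<forall>k\<ge>1. \<forall>r. \<bar>r\<bar> \<le> r0 \<longrightarrow> periodic2 (fk k r) \<and> periodic2 (gk k r)"
    and "\<forall>k\<ge>1. finite_S_harmonics r0 (fk k) \<and> finite_S_harmonics r0 (gk k)"
    and "p \<ge> 1"
    and "\<forall>k. 1 \<le> k \<and> k < p \<longrightarrow>
           (\<forall>\<phi> S. (\<lambda>r. \<bar>fk k r \<phi> S\<bar> + \<bar>gk k r \<phi> S\<bar>) \<in> O[at 0](\<lambda>r. r))"
    and "fourier_coeff (fk p 0) 0 0 \<noteq> 0"
    and "s 0 > 0"
    and "\<forall>k1 k2 :: int. \<bar>k1\<bar> + \<bar>k2\<bar> \<noteq> 0 \<longrightarrow> of_int k1 * \<omega> 0 + of_int k2 * s 0 \<noteq> 0"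
    and "p \<le> N" and "N < 2 * p"
    and "0 < rs" and "rs < r0"
    and "averaging_construction q s \<omega> fk gk N rs \<Lambda> v R"
    and "nonresonant_radius \<omega> (s 0) (S_frequencies fk \<Lambda> R N rs) rs"
    and "ts > 0" and "invertible_change q (phase q s) N v rs ts"
    and "n \<ge> 1"
    and "\<forall>k. 1 \<le> k \<and> k \<le> n - 1 \<longrightarrow> (\<forall>\<rho>. \<bar>\<rho>\<bar> \<le> rs \<longrightarrow> \<Lambda> k \<rho> = 0)"
    and "\<exists>\<rho>. \<bar>\<rho>\<bar> \<le> rs \<and> \<Lambda> n \<rho> \<noteq> 0"
    and "n < p" and "n = q"
    and "\<exists>h. h \<in> O[at 0](\<lambda>\<rho>. \<bar>\<rho>\<bar>) \<and> (\<forall>\<rho>. \<bar>\<rho>\<bar> \<le> rs \<longrightarrow> \<Lambda> n \<rho> = \<rho> * (lam + h \<rho>))"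
    and "lam < 0"
  shows "\<forall>\<epsilon>>0. \<exists>\<delta>0>0. \<exists>t0\<ge>ts. \<forall>J r \<phi>.
           solution_on r0 \<omega> f g (phase q s) J r \<phi> \<and> t0 \<in> J \<and> \<bar>r t0\<bar> \<le> \<delta>0 \<longrightarrow>
           (\<forall>t\<in>J. t0 \<le> t \<longrightarrow> \<bar>r t\<bar> < \<epsilon>)"
proof (intro allI impI)
  fix \<epsilon> :: real assume "\<epsilon> > 0"
  obtain d where "0 < d" and inward: "\<And>\<rho>. 0 < \<bar>\<rho>\<bar> \<Longrightarrow> \<bar>\<rho>\<bar> < d \<Longrightarrow> \<bar>\<rho>\<bar> \<le> rs \<Longrightarrow> sgn \<rho> * \<Lambda> q \<rho> \<le> 0"
  proof -
    obtain h where h: "h \<in> O[at 0](\<lambda>\<rho>. \<bar>\<rho>\<bar>)" and \<Lambda>: "\<And>\<rho>. \<bar>\<rho>\<bar> \<le> rs \<Longrightarrow> \<Lambda> q \<rho> = \<rho> * (lam + h \<rho>)"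
      using assms by blast
    obtain c where "c > 0" and "\<forall>\<^sub>F \<rho> in at 0. norm (h \<rho>) \<le> c * norm \<bar>\<rho>\<bar>"
      using h by (rule landau_o.bigE)
    then obtain d' where "0 < d'" and d': "\<forall>\<rho>\<in>UNIV. \<rho> \<noteq> 0 \<and> dist \<rho> 0 < d' \<longrightarrow> norm (h \<rho>) \<le> c * norm \<bar>\<rho>\<bar>"
      unfolding eventually_at by blast
    have c: "\<bar>h \<rho>\<bar> \<le> c * \<bar>\<rho>\<bar>" if "0 < \<bar>\<rho>\<bar>" "\<bar>\<rho>\<bar> < d'" for \<rho>
      using d'[rule_format, of \<rho>] that by simp
    show ?thesis
    proof (rule that[of "min d' (- lam / c)"])
      show "0 < min d' (- lam / c)" using \<open>0 < d'\<close> \<open>c > 0\<close> \<open>lam < 0\<close> by (simp add: divide_neg_pos)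
      fix \<rho> assume \<rho>: "0 < \<bar>\<rho>\<bar>" "\<bar>\<rho>\<bar> < min d' (- lam / c)" "\<bar>\<rho>\<bar> \<le> rs"
      have "\<bar>\<rho>\<bar> < - lam / c" using \<rho>(2) by simp
      then have "c * \<bar>\<rho>\<bar> < - lam"
        unfolding pos_less_divide_eq[OF \<open>c > 0\<close>] by (simp only: mult.commute)
      then have "lam + h \<rho> \<le> 0" using c[of \<rho>] \<rho> by linarith
      moreover have "sgn \<rho> * \<Lambda> q \<rho> = \<bar>\<rho>\<bar> * (lam + h \<rho>)" using \<Lambda>[OF \<rho>(3)] by (simp add: abs_sgn mult_ac)
      ultimately show "sgn \<rho> * \<Lambda> q \<rho> \<le> 0" by (simp add: mult_nonneg_nonpos)
    qed
  qed
  \<comment> \<open>Then \<open>{a..2 * a}\<close> does not exceed \<open>\<epsilon>\<close> and lies inside the slab and inside the inward region.\<close>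
  define a where "a = min (\<epsilon> / 2) (min (rs / 4) (d / 4))"
  have a: "0 < a" "2 * a \<le> \<epsilon>" "2 * a < rs" "2 * a < d"
    unfolding a_def using \<open>\<epsilon> > 0\<close> \<open>0 < rs\<close> \<open>0 < d\<close> by (auto simp: min_def)
  have "q \<le> N" using \<open>n < p\<close> \<open>n = q\<close> \<open>p \<le> N\<close> by simp
  have zero: "\<Lambda> j \<rho> = 0" if "1 \<le> j" "j < q" "\<bar>\<rho>\<bar> \<le> rs" for j \<rho>
    using assms(27) \<open>n = q\<close> that by auto
  obtain B C T where BCT: "0 \<le> B" "0 \<le> C" "1 \<le> T"
    and avg: "\<And>J r \<phi> t. solution_on r0 \<omega> f g (phase q s) J r \<phi> \<Longrightarrow> t \<in> J \<Longrightarrow> T \<le> t \<Longrightarrow>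
      a \<le> \<bar>r t\<bar> \<Longrightarrow> \<bar>r t\<bar> \<le> 2 * a \<Longrightarrow>
      \<bar>V_change q (phase q s) q v (r t) (\<phi> t) t - r t\<bar> \<le> B * t powr - (1 / real q) \<and>
      (\<exists>D. ((\<lambda>t. V_change q (phase q s) q v (r t) (\<phi> t) t) has_real_derivative D) (at t within J) \<and>
           \<bar>D - \<Lambda> q (r t) / t\<bar> \<le> C * t powr (- (1 / real q) - 1))"
    using averaging_on_annulus[OF \<open>q \<ge> 1\<close> \<open>q \<le> N\<close> \<open>rs < r0\<close> assms(8-11) assms(22) zero \<open>0 < a\<close> \<open>2 * a < rs\<close>]
    by blast
  have "((\<lambda>t. (2 * B + C / (1 / real q)) * t powr - (1 / real q)) \<longlongrightarrow> (2 * B + C / (1 / real q)) * 0) at_top"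
    using \<open>q \<ge> 1\<close> by (intro tendsto_mult tendsto_const tendsto_neg_powr filterlim_ident) auto
  then have "\<forall>\<^sub>F t in at_top. (2 * B + C / (1 / real q)) * t powr - (1 / real q) < a"
    using \<open>0 < a\<close> by (intro order_tendstoD(2)) auto
  then obtain T' where T': "\<And>t. T' \<le> t \<Longrightarrow> (2 * B + C / (1 / real q)) * t powr - (1 / real q) < a"
    unfolding eventually_at_top_linorder by blast
  define t0 where "t0 = max ts (max T T')"
  have t0: "ts \<le> t0" "T \<le> t0" "T' \<le> t0" unfolding t0_def by auto
  have "\<bar>r t1\<bar> < \<epsilon>"
    if sol: "solution_on r0 \<omega> f g (phase q s) J r \<phi>" and "t0 \<in> J" and "\<bar>r t0\<bar> \<le> a" and t1: "t1 \<in> J" "t0 \<le> t1"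
    for J r \<phi> t1
  proof -
    let ?V = "\<lambda>t. V_change q (phase q s) q v (r t) (\<phi> t) t"
    have J: "is_interval J" "J \<subseteq> {0<..}" and cont: "continuous_on J r"
      using sol unfolding solution_on_def by (auto simp: continuous_on_eq_continuous_within intro: DERIV_continuous)
    \<comment> \<open>The sign \<open>\<tau>\<close> turns growth of \<open>\<bar>r\<bar>\<close> on either side of the origin into an ascent.\<close>
    have one_side: "\<tau> * r t1 < 2 * a" if \<tau>: "\<tau> = 1 \<or> \<tau> = - 1" for \<tau> :: real
    proof (rule barrier[where u = "\<lambda>t. \<tau> * r t" and W = "\<lambda>t. \<tau> * ?V t" and \<kappa> = "1 / real q",
          OF J _ _ \<open>0 < a\<close> \<open>0 \<le> B\<close> \<open>0 \<le> C\<close> \<open>t0 \<in> J\<close> _ _ _ T'[OF t0(3)] t1])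
      fix t assume t: "t \<in> J" "t0 \<le> t" "a \<le> \<tau> * r t" "\<tau> * r t \<le> 2 * a"
      have abs: "\<bar>r t\<bar> = \<tau> * r t" and sgn: "sgn (r t) = \<tau>" using \<tau> t(3) \<open>0 < a\<close> by (auto simp: sgn_if)
      have "T \<le> t" using t t0 by linarith
      note est = avg[OF sol t(1) this, unfolded abs, OF t(3,4)]
      show "\<bar>\<tau> * ?V t - \<tau> * r t\<bar> \<le> B * t powr - (1 / real q)"
        using est \<tau> by (auto simp: abs_minus_commute)
      obtain D where D: "(?V has_real_derivative D) (at t within J)"
        "\<bar>D - \<Lambda> q (r t) / t\<bar> \<le> C * t powr (- (1 / real q) - 1)" using est by blast
      have "\<tau> * \<Lambda> q (r t) \<le> 0" using inward[of "r t", unfolded sgn abs] t a by auto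
      then have "\<tau> * (\<Lambda> q (r t) / t) \<le> 0" using t(1) J(2) by (auto simp: divide_nonpos_pos)
      moreover have "\<tau> * D - \<tau> * (\<Lambda> q (r t) / t) \<le> \<bar>D - \<Lambda> q (r t) / t\<bar>" using \<tau> by auto
      ultimately have "\<tau> * D \<le> C * t powr (- (1 / real q) - 1)" using D(2) by linarith
      then show "\<exists>D. ((\<lambda>t. \<tau> * ?V t) has_real_derivative D) (at t within J) \<and> D \<le> C * t powr (- (1 / real q) - 1)"
        using DERIV_cmult[OF D(1), of \<tau>] by blast
    qed (use \<tau> \<open>q \<ge> 1\<close> \<open>\<bar>r t0\<bar> \<le> a\<close> in \<open>auto intro!: continuous_intros cont\<close>)
    show ?thesis using one_side[of 1] one_side[of "- 1"] a(2) by auto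
  qed
  then show "\<exists>\<delta>0>0. \<exists>t0\<ge>ts. \<forall>J r \<phi>.
           solution_on r0 \<omega> f g (phase q s) J r \<phi> \<and> t0 \<in> J \<and> \<bar>r t0\<bar> \<le> \<delta>0 \<longrightarrow>
           (\<forall>t\<in>J. t0 \<le> t \<longrightarrow> \<bar>r t\<bar> < \<epsilon>)"
    using \<open>0 < a\<close> t0(1) by blast
qed

end
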